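(* Let $C$ be a $k$-graph with a finite number of identities which is row finite and has no sources. Then the topological groupoid $\mathcal{G}(C)$ is isomorphic, as a topological groupoid, to the étale groupoid of ultrafilters of $\mathsf{B}(C)$ (the groupoid associated with the Boolean inverse monoid $\mathsf{B}(C)$ under non-commutative Stone duality).
   Context: Categories and higher rank graphs. $\mathbb{N}=\{0,1,2,\dots\}$, $\mathbb{N}^k$ ordered componentwise. A category $C$ is regarded as a set of arrows with set of identities $C_o\subseteq C$; each arrow $a$ has domain $\mathbf{d}(a)\in C_o$ and codomain $\mathbf{r}(a)\in C_o$, and $ab$ is defined exactly when $\mathbf{d}(a)=\mathbf{r}(b)$. Put $XC=\{xc: x\in X, c\in C, xc\text{ defined}\}$. A $k$-graph is a countable category $C$ with a functor $d\colon C\to\mathbb{N}^k$ (the degree) such that whenever $d(a)=\mathbf{m}+\mathbf{n}$ there are unique $a_1,a_2$ with $a=a_1a_2$, $d(a_1)=\mathbf{m}$, $d(a_2)=\mathbf{n}$. It has no sources if for each $e\in C_o$ and $\mathbf{m}\in\mathbb{N}^k$ there is $x$ with $\mathbf{r}(x)=e$, $d(x)=\mathbf{m}$; it is row finite if the number of such $x$ is always finite. The groupoid $\mathcal{G}(C)$. A $k$-tiling of $C$ is a family $w(\mathbf{m},\mathbf{n})\in C$ for $\mathbf{m}\le\mathbf{n}$ in $\mathbb{N}^k$ with $w(\mathbf{m},\mathbf{m})$ an identity, $w(\mathbf{m},\mathbf{n})w(\mathbf{n},\mathbf{p})=w(\mathbf{m},\mathbf{p})$ and $d(w(\mathbf{m},\mathbf{n}))=\mathbf{n}-\mathbf{m}$.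 $C^\infty$ is the set of $k$-tilings, $\mathbf{r}(w)=w(\mathbf{0},\mathbf{0})$, $C^\infty(e)=\{w:\mathbf{r}(w)=e\}$, and $\sigma^{\mathbf{p}}(w)(\mathbf{m},\mathbf{n})=w(\mathbf{p}+\mathbf{m},\mathbf{p}+\mathbf{n})$. If $\mathbf{d}(x)=\mathbf{r}(w)$, then $xw$ is the unique $k$-tiling with $(xw)(\mathbf{0},d(x))=x$ and $\sigma^{d(x)}(xw)=w$. $\mathcal{G}(C)$ is the set of triples $(w_1,\mathbf{n},w_2)\in C^\infty\times\mathbb{Z}^k\times C^\infty$ for which there are $\mathbf{l},\mathbf{m}\in\mathbb{N}^k$ with $\mathbf{n}=\mathbf{l}-\mathbf{m}$ and $\sigma^{\mathbf{l}}(w_1)=\sigma^{\mathbf{m}}(w_2)$, with $\mathbf{d}(w_1,\mathbf{n},w_2)=(w_2,\mathbf{0},w_2)$, $\mathbf{r}(w_1,\mathbf{n},w_2)=(w_1,\mathbf{0},w_1)$, product $(w_1,\mathbf{m},w_2)(w_2,\mathbf{n},w_3)=(w_1,\mathbf{m}+\mathbf{n},w_3)$, inverse $(w_1,\mathbf{n},w_2)^{-1}=(w_2,-\mathbf{n},w_1)$, and topology with base the sets $Z(x,y)=\{(xw,d(x)-d(y),yw): w\in C^\infty(\mathbf{d}(x))\}$ for $x,y\in C$ with $\mathbf{d}(x)=\mathbf{d}(y)$. The monoid $\mathsf{B}(C)$. A right ideal of $C$ is a (possibly empty) subset $R$ with $RC\subseteq R$; it is finitely generated if $R=XC$ with $X$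 finite. A bijective morphism $\theta\colon R_1\to R_2$ of right ideals is a bijection with $\mathbf{d}(\theta(r))=\mathbf{d}(r)$ and $\theta(rc)=\theta(r)c$ whenever $rc$ is defined. $\mathsf{R}(C)$ is the inverse monoid of bijective morphisms between finitely generated right ideals under composition of partial bijections (zero: the empty function). With $a\le b\Leftrightarrow a=ba^{-1}a$, the Lenz congruence is: $s\equiv t$ iff for each $0<x\le s$ there is a non-zero element below both $x$ and $t$, and for each $0<y\le t$ there is a non-zero element below both $y$ and $s$. $\mathsf{B}(C)=\mathsf{R}(C)/{\equiv}$, a Boolean inverse monoid. The groupoid of ultrafilters of a Boolean inverse monoid $S$. A filter is a non-empty up-closed, down-directed subset of $S$ (for $\le$); it is proper if it omits $0$; an ultrafilter is a maximal proper filter. For a subset $Y$, $Y^\uparrow$ is the set of elements above some element of $Y$. The elements of the groupoid are the ultrafilters of $S$; $\mathbf{d}(A)=(A^{-1}A)^\uparrow$, $\mathbf{r}(A)=(AA^{-1})^\uparrow$; if $\mathbf{d}(A)=\mathbf{r}(B)$ then $A\cdot B=(AB)^\uparrow$; the inverse of $A$ is $A^{-1}$; a base for the topology is given by the sets $\{A : s\in A\}$, $s\in S$. *)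

theory Defs
  imports "HOL-Analysis.Analysis" "HOL-Algebra.Group"
begin

section \<open>Categories as sets of arrows\<close>

text \<open>As in function composition, \<open>a \<cdot> b\<close> is defined when the domain of \<open>a\<close> is the
  codomain of \<open>b\<close>. An identity is identified with the object it stands for; in a category the
  identities are exactly the arrows of the form \<open>dm C a\<close>.\<close>

record 'a arrow_category =
  arrows :: "'a set"
  dm :: "'a \<Rightarrow> 'a"
  rg :: "'a \<Rightarrow> 'a"
  cmp :: "'a \<Rightarrow> 'a \<Rightarrow> 'a"  (infixl "\<cdot>\<index>" 70)

definition idents :: "('a, 'm) arrow_category_scheme \<Rightarrow> 'a set" where
  "idents C = dm C ` arrows C"

definition composable :: "('a, 'm) arrow_category_scheme \<Rightarrow> 'a \<Rightarrow> 'a \<Rightarrow> bool" where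
  "composable C a b \<longleftrightarrow> a \<in> arrows C \<and> b \<in> arrows C \<and> dm C a = rg C b"

locale arrow_cat =
  fixes C :: "('a, 'm) arrow_category_scheme" (structure)
  assumes idents_arrows: "e \<in> idents C \<Longrightarrow> e \<in> arrows C"
    and rg_idents: "a \<in> arrows C \<Longrightarrow> rg C a \<in> idents C"
    and dm_ident: "e \<in> idents C \<Longrightarrow> dm C e = e"
    and rg_ident: "e \<in> idents C \<Longrightarrow> rg C e = e"
    and cmp_arrows: "composable C a b \<Longrightarrow> a \<cdot> b \<in> arrows C"
    and dm_cmp: "composable C a b \<Longrightarrow> dm C (a \<cdot> b) = dm C b"
    and rg_cmp: "composable C a b \<Longrightarrow> rg C (a \<cdot> b) = rg C a"
    and cmp_dm: "a \<in> arrows C \<Longrightarrow> a \<cdot> dm C a = a"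
    and rg_cmp_self: "a \<in> arrows C \<Longrightarrow> rg C a \<cdot> a = a"
    and cmp_assoc: "composable C a b \<Longrightarrow> composable C b c \<Longrightarrow> (a \<cdot> b) \<cdot> c = a \<cdot> (b \<cdot> c)"

definition set_cmp :: "('a, 'm) arrow_category_scheme \<Rightarrow> 'a set \<Rightarrow> 'a set \<Rightarrow> 'a set" where
  "set_cmp C X Y = {cmp C x y | x y. x \<in> X \<and> y \<in> Y \<and> composable C x y}"


section \<open>Higher rank graphs\<close>

record ('a, 'k) graph_category = "'a arrow_category" +
  deg :: "'a \<Rightarrow> nat ^ 'k"

locale k_graph = arrow_cat C
  for C :: "('a, 'k::finite, 'm) graph_category_scheme" (structure) +
  assumes countable_arrows: "countable (arrows C)"
    and deg_ident: "e \<in> idents C \<Longrightarrow> deg C e = 0"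
    and deg_cmp: "composable C a b \<Longrightarrow> deg C (a \<cdot> b) = deg C a + deg C b"
    and unique_factorization: "a \<in> arrows C \<Longrightarrow> deg C a = m + n \<Longrightarrow>
      \<exists>!(a1, a2). composable C a1 a2 \<and> a = a1 \<cdot> a2 \<and> deg C a1 = m \<and> deg C a2 = n"

definition no_sources :: "('a, 'k::finite, 'm) graph_category_scheme \<Rightarrow> bool" where
  "no_sources C \<longleftrightarrow>
    (\<forall>e\<in>idents C. \<forall>m. \<exists>x\<in>arrows C. rg C x = e \<and> deg C x = m)"

definition row_finite :: "('a, 'k::finite, 'm) graph_category_scheme \<Rightarrow> bool" where
  "row_finite C \<longleftrightarrow>
    (\<forall>e\<in>idents C. \<forall>m. finite {x \<in> arrows C. rg C x = e \<and> deg C x = m})"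


section \<open>Topological groupoids\<close>

record 'a groupoid_space = "'a arrow_category" +
  ginv :: "'a \<Rightarrow> 'a"
  gtop :: "'a topology"

locale arrow_groupoid = arrow_cat G
  for G :: "('a, 'm) groupoid_space_scheme" (structure) +
  assumes ginv_arrows: "a \<in> arrows G \<Longrightarrow> ginv G a \<in> arrows G"
    and dm_ginv: "a \<in> arrows G \<Longrightarrow> dm G (ginv G a) = rg G a"
    and rg_ginv: "a \<in> arrows G \<Longrightarrow> rg G (ginv G a) = dm G a"
    and ginv_cmp: "a \<in> arrows G \<Longrightarrow> ginv G a \<cdot> a = dm G a"
    and cmp_ginv: "a \<in> arrows G \<Longrightarrow> a \<cdot> ginv G a = rg G a"

locale topological_groupoid = arrow_groupoid G
  for G :: "('a, 'm) groupoid_space_scheme" (structure) +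
  assumes topspace_gtop: "topspace (gtop G) = arrows G"
    and continuous_ginv: "continuous_map (gtop G) (gtop G) (ginv G)"
    and continuous_cmp: "continuous_map
      (subtopology (prod_topology (gtop G) (gtop G)) {(a, b). composable G a b})
      (gtop G) (\<lambda>(a, b). a \<cdot> b)"

text \<open>Etale: the domain map is a local homeomorphism onto the space of identities.\<close>

locale etale_groupoid = topological_groupoid G
  for G :: "('a, 'm) groupoid_space_scheme" (structure) +
  assumes local_homeomorphism_dm: "a \<in> arrows G \<Longrightarrow>
      \<exists>U. openin (gtop G) U \<and> a \<in> U \<and>
          openin (subtopology (gtop G) (idents G)) (dm G ` U) \<and>
          homeomorphic_map (subtopology (gtop G) U) (subtopology (gtop G) (dm G ` U)) (dm G)"

definition topological_groupoid_isomorphism ::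
    "('a, 'm) groupoid_space_scheme \<Rightarrow> ('b, 'n) groupoid_space_scheme \<Rightarrow> ('a \<Rightarrow> 'b) \<Rightarrow> bool" where
  "topological_groupoid_isomorphism G H f \<longleftrightarrow>
    bij_betw f (arrows G) (arrows H) \<and>
    (\<forall>a\<in>arrows G. f (dm G a) = dm H (f a) \<and> f (rg G a) = rg H (f a)) \<and>
    (\<forall>a b. composable G a b \<longrightarrow> f (cmp G a b) = cmp H (f a) (f b)) \<and>
    (\<forall>a\<in>arrows G. f (ginv G a) = ginv H (f a)) \<and>
    homeomorphic_map (gtop G) (gtop H) f"

definition isomorphic_topological_groupoids ::
    "('a, 'm) groupoid_space_scheme \<Rightarrow> ('b, 'n) groupoid_space_scheme \<Rightarrow> bool" where
  "isomorphic_topological_groupoids G H \<longleftrightarrow> (\<exists>f. topological_groupoid_isomorphism G H f)"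


section \<open>The groupoid of tilings\<close>

text \<open>A family indexed by the pairs \<open>m \<le> n\<close> is a function that is \<open>undefined\<close> elsewhere, so that
  equal families are equal functions.\<close>

type_synonym ('a, 'k) family = "nat ^ 'k \<Rightarrow> nat ^ 'k \<Rightarrow> 'a"

definition tilings :: "('a, 'k::finite, 'm) graph_category_scheme \<Rightarrow> ('a, 'k) family set" where
  "tilings C = {w.
    (\<forall>m n. m \<le> n \<longrightarrow> w m n \<in> arrows C \<and> deg C (w m n) = n - m) \<and>
    (\<forall>m n. \<not> m \<le> n \<longrightarrow> w m n = undefined) \<and>
    (\<forall>m. w m m \<in> idents C) \<and>
    (\<forall>m n p. m \<le> n \<and> n \<le> p \<longrightarrow>
        composable C (w m n) (w n p) \<and> cmp C (w m n) (w n p) = w m p)}"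

definition tiling_range :: "('a, 'k::finite) family \<Rightarrow> 'a" where
  "tiling_range w = w 0 0"

definition shift :: "nat ^ 'k::finite \<Rightarrow> ('a, 'k) family \<Rightarrow> ('a, 'k) family" where
  "shift p w = (\<lambda>m n. w (p + m) (p + n))"

definition prepend ::
    "('a, 'k::finite, 'm) graph_category_scheme \<Rightarrow> 'a \<Rightarrow> ('a, 'k) family \<Rightarrow> ('a, 'k) family" where
  "prepend C x w = (THE v. v \<in> tilings C \<and> v 0 (deg C x) = x \<and> shift (deg C x) v = w)"

definition int_vec :: "nat ^ 'k::finite \<Rightarrow> int ^ 'k" where
  "int_vec m = (\<chi> i. int (m $ i))"

type_synonym ('a, 'k) tiling_triple = "('a, 'k) family \<times> (int ^ 'k) \<times> ('a, 'k) family"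

definition tiling_cylinder ::
    "('a, 'k::finite, 'm) graph_category_scheme \<Rightarrow> 'a \<Rightarrow> 'a \<Rightarrow> ('a, 'k) tiling_triple set" where
  "tiling_cylinder C x y =
    {(prepend C x w, int_vec (deg C x) - int_vec (deg C y), prepend C y w) | w.
       w \<in> tilings C \<and> tiling_range w = dm C x}"

text \<open>Both here and for the groupoid of ultrafilters the sets generating the topology form a
  base, so \<open>topology_generated_by\<close>, which only needs a subbase, yields the topology with that base.\<close>

definition tiling_groupoid ::
    "('a, 'k::finite, 'm) graph_category_scheme \<Rightarrow> ('a, 'k) tiling_triple groupoid_space" where
  "tiling_groupoid C =
    \<lparr>arrows = {(w1, n, w2). w1 \<in> tilings C \<and> w2 \<in> tilings C \<and>
        (\<exists>l m. n = int_vec l - int_vec m \<and> shift l w1 = shift m w2)},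
     dm = (\<lambda>(w1, n, w2). (w2, 0, w2)),
     rg = (\<lambda>(w1, n, w2). (w1, 0, w1)),
     cmp = (\<lambda>(w1, m, w2) (w2', n, w3). (w1, m + n, w3)),
     ginv = (\<lambda>(w1, n, w2). (w2, - n, w1)),
     gtop = topology_generated_by
       {tiling_cylinder C x y | x y. x \<in> arrows C \<and> y \<in> arrows C \<and> dm C x = dm C y}\<rparr>"


section \<open>Inverse monoids with zero and the Lenz congruence\<close>

record 'a inverse_monoid = "'a monoid" +
  minv :: "'a \<Rightarrow> 'a"
  mzero :: 'a

definition nat_le :: "('a, 'm) inverse_monoid_scheme \<Rightarrow> 'a \<Rightarrow> 'a \<Rightarrow> bool" where
  "nat_le S a b \<longleftrightarrow> a = b \<otimes>\<^bsub>S\<^esub> minv S a \<otimes>\<^bsub>S\<^esub> a"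

definition lenz_half :: "('a, 'm) inverse_monoid_scheme \<Rightarrow> 'a \<Rightarrow> 'a \<Rightarrow> bool" where
  "lenz_half S s t \<longleftrightarrow>
    (\<forall>x\<in>carrier S. x \<noteq> mzero S \<and> nat_le S x s \<longrightarrow>
      (\<exists>z\<in>carrier S. z \<noteq> mzero S \<and> nat_le S z x \<and> nat_le S z t))"

definition lenz :: "('a, 'm) inverse_monoid_scheme \<Rightarrow> ('a \<times> 'a) set" where
  "lenz S = {(s, t). s \<in> carrier S \<and> t \<in> carrier S \<and> lenz_half S s t \<and> lenz_half S t s}"

text \<open>The operations on classes are those induced by representatives; as the relation is a
  congruence, each of the unions below is a union of copies of a single class.\<close>

definition lenz_quotient :: "('a, 'm) inverse_monoid_scheme \<Rightarrow> 'a set inverse_monoid" where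
  "lenz_quotient S =
    \<lparr>carrier = carrier S // lenz S,
     mult = (\<lambda>X Y. \<Union>s\<in>X. \<Union>t\<in>Y. lenz S `` {s \<otimes>\<^bsub>S\<^esub> t}),
     one = lenz S `` {\<one>\<^bsub>S\<^esub>},
     minv = (\<lambda>X. \<Union>s\<in>X. lenz S `` {minv S s}),
     mzero = lenz S `` {mzero S}\<rparr>"


section \<open>Bijective morphisms between finitely generated right ideals\<close>

definition right_ideal :: "('a, 'm) arrow_category_scheme \<Rightarrow> 'a set \<Rightarrow> bool" where
  "right_ideal C R \<longleftrightarrow> R \<subseteq> arrows C \<and> set_cmp C R (arrows C) \<subseteq> R"

definition fg_right_ideal :: "('a, 'm) arrow_category_scheme \<Rightarrow> 'a set \<Rightarrow> bool" where
  "fg_right_ideal C R \<longleftrightarrow> right_ideal C R \<and>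
    (\<exists>X. finite X \<and> X \<subseteq> arrows C \<and> R = set_cmp C X (arrows C))"

text \<open>A bijection from \<open>R1\<close> to \<open>R2\<close> is encoded as an injective partial map \<open>\<theta>\<close> with
  \<open>dom \<theta> = R1\<close> and \<open>ran \<theta> = R2\<close>.\<close>

definition bijective_morphism ::
    "('a, 'm) arrow_category_scheme \<Rightarrow> 'a set \<Rightarrow> 'a set \<Rightarrow> ('a \<rightharpoonup> 'a) \<Rightarrow> bool" where
  "bijective_morphism C R1 R2 \<theta> \<longleftrightarrow>
    dom \<theta> = R1 \<and> ran \<theta> = R2 \<and> inj_on \<theta> R1 \<and>
    (\<forall>r\<in>R1. dm C (the (\<theta> r)) = dm C r) \<and>
    (\<forall>r\<in>R1. \<forall>c. composable C r c \<longrightarrow> \<theta> (cmp C r c) = Some (cmp C (the (\<theta> r)) c))"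

definition partial_inverse :: "('a \<rightharpoonup> 'a) \<Rightarrow> ('a \<rightharpoonup> 'a)" where
  "partial_inverse \<theta> = (\<lambda>y. if y \<in> ran \<theta> then Some (THE x. \<theta> x = Some y) else None)"

definition R_monoid :: "('a, 'm) arrow_category_scheme \<Rightarrow> ('a \<rightharpoonup> 'a) inverse_monoid" where
  "R_monoid C =
    \<lparr>carrier = {\<theta>. \<exists>R1 R2. fg_right_ideal C R1 \<and> fg_right_ideal C R2 \<and>
        bijective_morphism C R1 R2 \<theta>},
     mult = (\<lambda>\<theta> \<phi>. \<theta> \<circ>\<^sub>m \<phi>),
     one = Some |` arrows C,
     minv = partial_inverse,
     mzero = Map.empty\<rparr>"

definition B_monoid :: "('a, 'm) arrow_category_scheme \<Rightarrow> ('a \<rightharpoonup> 'a) set inverse_monoid" where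
  "B_monoid C = lenz_quotient (R_monoid C)"


section \<open>The groupoid of ultrafilters\<close>

definition is_filter :: "('a, 'm) inverse_monoid_scheme \<Rightarrow> 'a set \<Rightarrow> bool" where
  "is_filter S F \<longleftrightarrow> F \<subseteq> carrier S \<and> F \<noteq> {} \<and>
    (\<forall>a\<in>F. \<forall>b\<in>carrier S. nat_le S a b \<longrightarrow> b \<in> F) \<and>
    (\<forall>a\<in>F. \<forall>b\<in>F. \<exists>c\<in>F. nat_le S c a \<and> nat_le S c b)"

definition proper_filter :: "('a, 'm) inverse_monoid_scheme \<Rightarrow> 'a set \<Rightarrow> bool" where
  "proper_filter S F \<longleftrightarrow> is_filter S F \<and> mzero S \<notin> F"

definition is_ultrafilter :: "('a, 'm) inverse_monoid_scheme \<Rightarrow> 'a set \<Rightarrow> bool" where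
  "is_ultrafilter S F \<longleftrightarrow> proper_filter S F \<and> (\<forall>F'. proper_filter S F' \<and> F \<subseteq> F' \<longrightarrow> F' = F)"

definition up_closure :: "('a, 'm) inverse_monoid_scheme \<Rightarrow> 'a set \<Rightarrow> 'a set" where
  "up_closure S Y = {b \<in> carrier S. \<exists>a\<in>Y. nat_le S a b}"

definition subset_prod :: "('a, 'm) inverse_monoid_scheme \<Rightarrow> 'a set \<Rightarrow> 'a set \<Rightarrow> 'a set" where
  "subset_prod S A B = {a \<otimes>\<^bsub>S\<^esub> b | a b. a \<in> A \<and> b \<in> B}"

definition ultrafilter_groupoid :: "('a, 'm) inverse_monoid_scheme \<Rightarrow> 'a set groupoid_space" where
  "ultrafilter_groupoid S =
    \<lparr>arrows = {A. is_ultrafilter S A},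
     dm = (\<lambda>A. up_closure S (subset_prod S (minv S ` A) A)),
     rg = (\<lambda>A. up_closure S (subset_prod S A (minv S ` A))),
     cmp = (\<lambda>A B. up_closure S (subset_prod S A B)),
     ginv = (\<lambda>A. minv S ` A),
     gtop = topology_generated_by {{A. is_ultrafilter S A \<and> s \<in> A} | s. s \<in> carrier S}\<rparr>"

end

theory Submission
  imports Defs
begin

text \<open>A bijective morphism \<open>\<theta>\<close> between finitely generated right ideals acts on tilings by
  replacing an initial segment \<open>r\<close> by \<open>\<theta> r\<close>. Its germs form a subset \<open>germs C \<theta>\<close> of the groupoid
  of tilings, and the idea is that the map \<open>germs C\<close> identifies the quotient monoid with a monoid
  of compact open bisections of that groupoid, whose ultrafilters are the points of the groupoid.

  The part that concerns an arbitrary groupoid \<open>G\<close> is isolated in the locale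
  \<open>bisection_representation\<close>: an inverse monoid \<open>S\<close> is mapped, compatibly with products and
  inverses, onto a base of compact clopen bisections of \<open>G\<close>. Then the Lenz congruence is the kernel of this map
  (\<open>lenz_half_iff\<close>), because a point of one bisection outside another has a neighbourhood
  disjoint from the latter; hence the quotient is represented faithfully
  (\<open>lenz_quotient_representation\<close>). For a faithful representation every proper filter has a
  common point by compactness, and points are separated by the base, so the ultrafilters are
  exactly the sets of all bisections through one point. The formulas for the operations of the
  ultrafilter groupoid then amount to the fact that the product of \<open>G\<close> can be followed backwards
  in small bisections (\<open>rep_split\<close>), which is also its continuity. The map from points to
  ultrafilters carries the topology and the groupoid structure over.

  It remains to verify the axioms for the germs of morphisms. Prepending an arrow to a tiling
  gives products of bisections, and translations \<open>y \<cdot> c \<mapsto> x \<cdot> c\<close> give the basic open sets. The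
  sets of germs are clopen because, by finite generation, whether \<open>\<theta>\<close> is defined along a tiling
  is decided by an initial segment of bounded degree (\<open>germs_clopen\<close>). Row-finiteness and the
  finiteness of the set of identities give compactness, by growing a tiling one step of degree
  \<open>(1, \<dots>, 1)\<close> at a time (\<open>germs_compact\<close>). Row-finiteness also makes the domain of the composite
  of two morphisms finitely generated (\<open>fg_morphism_comp\<close>). The absence of sources ensures that every non-zero
  morphism has a germ (\<open>germs_nonempty\<close>).\<close>


section \<open>Categories and groupoids\<close>

context arrow_cat
begin

lemma dm_idents: "a \<in> arrows C \<Longrightarrow> dm C a \<in> idents C"
  by (simp add: idents_def)

lemma dm_arrows: "a \<in> arrows C \<Longrightarrow> dm C a \<in> arrows C"
  by (simp add: dm_idents idents_arrows)

lemma rg_arrows: "a \<in> arrows C \<Longrightarrow> rg C a \<in> arrows C"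
  by (simp add: rg_idents idents_arrows)

lemma composable_cmp:
  assumes "composable C a b" "composable C b c"
  shows "composable C (a \<cdot> b) c" "composable C a (b \<cdot> c)"
  using assms dm_cmp[of a b] rg_cmp[of b c] cmp_arrows by (auto simp: composable_def)

end

context arrow_groupoid
begin

lemma ginv_cmp_cancel:
  assumes "composable G a b"
  shows "ginv G a \<cdot> (a \<cdot> b) = b"
proof -
  have "ginv G a \<cdot> (a \<cdot> b) = (ginv G a \<cdot> a) \<cdot> b"
    using assms by (simp add: cmp_assoc composable_def dm_ginv ginv_arrows)
  also have "\<dots> = b"
    using assms by (simp add: ginv_cmp composable_def rg_cmp_self)
  finally show ?thesis .
qed

lemma cmp_ginv_cancel:
  assumes "composable G a b"
  shows "(a \<cdot> b) \<cdot> ginv G b = a"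
proof -
  have "(a \<cdot> b) \<cdot> ginv G b = a \<cdot> (b \<cdot> ginv G b)"
    using assms by (intro cmp_assoc) (auto simp: composable_def rg_ginv ginv_arrows)
  also have "\<dots> = a"
    using assms cmp_dm[of a] by (simp add: cmp_ginv composable_def)
  finally show ?thesis .
qed

lemma ginv_ginv:
  assumes "a \<in> arrows G"
  shows "ginv G (ginv G a) = a"
proof -
  have c: "composable G (ginv G a) a"
    using assms by (simp add: composable_def dm_ginv ginv_arrows)
  have "ginv G (ginv G a) = ginv G (ginv G a) \<cdot> dm G (ginv G (ginv G a))"
    using assms by (simp add: cmp_dm ginv_arrows)
  also have "\<dots> = ginv G (ginv G a) \<cdot> (ginv G a \<cdot> a)"
    using assms by (simp add: dm_ginv rg_ginv ginv_arrows ginv_cmp)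
  finally show ?thesis
    using ginv_cmp_cancel[OF c] by simp
qed

end


section \<open>Inverse monoids represented by compact open bisections\<close>

text \<open>What the duality uses of \<open>G\<close> is a base of compact clopen bisections closed under products
  and inverses, indexed by \<open>S\<close>. The map \<open>U\<close> may identify elements, because the monoid of morphisms
  is to be an instance before the passage to the quotient. Compactness has the form in which
  filters use it, downward directed families of non-empty sets. A bisection is expressed by
  injectivity of the domain map, from which that of the codomain map follows by passing to
  inverses.\<close>

locale bisection_representation = arrow_groupoid G
  for G :: "('g, 'n) groupoid_space_scheme" (structure)
    and S :: "('a, 'm) inverse_monoid_scheme"
    and U :: "'a \<Rightarrow> 'g set" +
  assumes mult_closed: "s \<in> carrier S \<Longrightarrow> t \<in> carrier S \<Longrightarrow> s \<otimes>\<^bsub>S\<^esub> t \<in> carrier S"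
    and minv_closed: "s \<in> carrier S \<Longrightarrow> minv S s \<in> carrier S"
    and mzero_closed: "mzero S \<in> carrier S"
    and rep_subset: "s \<in> carrier S \<Longrightarrow> U s \<subseteq> arrows G"
    and rep_mult: "s \<in> carrier S \<Longrightarrow> t \<in> carrier S \<Longrightarrow> U (s \<otimes>\<^bsub>S\<^esub> t) = set_cmp G (U s) (U t)"
    and rep_minv: "s \<in> carrier S \<Longrightarrow> U (minv S s) = ginv G ` U s"
    and rep_mzero: "U (mzero S) = {}"
    and rep_nonempty: "s \<in> carrier S \<Longrightarrow> s \<noteq> mzero S \<Longrightarrow> U s \<noteq> {}"
    and rep_bisection: "s \<in> carrier S \<Longrightarrow> inj_on (dm G) (U s)"
    and rep_meet: "s \<in> carrier S \<Longrightarrow> t \<in> carrier S \<Longrightarrow> g \<in> U s \<Longrightarrow> g \<in> U t \<Longrightarrow>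
      \<exists>r\<in>carrier S. g \<in> U r \<and> nat_le S r s \<and> nat_le S r t"
    and rep_cover: "g \<in> arrows G \<Longrightarrow> \<exists>s\<in>carrier S. g \<in> U s"
    and rep_clopen: "s \<in> carrier S \<Longrightarrow> g \<in> arrows G \<Longrightarrow> g \<notin> U s \<Longrightarrow>
      \<exists>t\<in>carrier S. g \<in> U t \<and> U t \<inter> U s = {}"
    and rep_separated: "g \<in> arrows G \<Longrightarrow> h \<in> arrows G \<Longrightarrow>
      (\<And>s. s \<in> carrier S \<Longrightarrow> g \<in> U s \<Longrightarrow> h \<in> U s) \<Longrightarrow> g = h"
    and rep_compact: "D \<subseteq> carrier S \<Longrightarrow> D \<noteq> {} \<Longrightarrow> (\<And>s. s \<in> D \<Longrightarrow> U s \<noteq> {}) \<Longrightarrow>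
      (\<And>s t. s \<in> D \<Longrightarrow> t \<in> D \<Longrightarrow> \<exists>r\<in>D. U r \<subseteq> U s \<inter> U t) \<Longrightarrow> \<exists>g. \<forall>s\<in>D. g \<in> U s"
    and rep_gtop: "gtop G = topology_generated_by (U ` carrier S)"
begin

lemma rep_arrows: "s \<in> carrier S \<Longrightarrow> g \<in> U s \<Longrightarrow> g \<in> arrows G"
  using rep_subset by blast

lemma rep_multI:
  assumes "s \<in> carrier S" "t \<in> carrier S" "g \<in> U s" "h \<in> U t" "dm G g = rg G h"
  shows "g \<cdot> h \<in> U (s \<otimes>\<^bsub>S\<^esub> t)"
  using assms rep_subset[of s] rep_subset[of t]
  unfolding rep_mult[OF assms(1,2)] set_cmp_def composable_def by blast

lemma rep_multE:
  assumes "s \<in> carrier S" "t \<in> carrier S" "k \<in> U (s \<otimes>\<^bsub>S\<^esub> t)"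
  obtains g h where "g \<in> U s" "h \<in> U t" "composable G g h" "k = g \<cdot> h"
  using assms(3) unfolding rep_mult[OF assms(1,2)] set_cmp_def by blast

lemma rep_minvI: "s \<in> carrier S \<Longrightarrow> g \<in> U s \<Longrightarrow> ginv G g \<in> U (minv S s)"
  by (simp add: rep_minv)

lemma rep_bisection_rg:
  assumes "s \<in> carrier S" "g \<in> U s" "h \<in> U s" "rg G g = rg G h"
  shows "g = h"
proof -
  have gh: "g \<in> arrows G" "h \<in> arrows G"
    using assms rep_arrows by auto
  have "ginv G g = ginv G h"
    using rep_bisection[OF minv_closed[OF assms(1)]] assms gh
    by (auto simp: inj_on_def rep_minv dm_ginv)
  then show ?thesis
    using gh ginv_ginv by metis
qed

text \<open>As \<open>U t\<close> is a bisection, the product of its inverse with itself consists of identities,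
  so that multiplying by it only restricts domains.\<close>

lemma rep_cancel_subset:
  assumes s: "s \<in> carrier S" and t: "t \<in> carrier S"
  shows "U (s \<otimes>\<^bsub>S\<^esub> minv S t \<otimes>\<^bsub>S\<^esub> t) \<subseteq> {k \<in> U s. dm G k \<in> dm G ` U t}"
proof
  fix k assume "k \<in> U (s \<otimes>\<^bsub>S\<^esub> minv S t \<otimes>\<^bsub>S\<^esub> t)"
  then obtain f c where f: "f \<in> U (s \<otimes>\<^bsub>S\<^esub> minv S t)" "c \<in> U t" "composable G f c" "k = f \<cdot> c"
    by (rule rep_multE[OF mult_closed[OF s minv_closed[OF t]] t])
  obtain a b where a: "a \<in> U s" "b \<in> U (minv S t)" "composable G a b" "f = a \<cdot> b"
    using rep_multE[of s "minv S t" f] f(1) s t by (auto intro: minv_closed)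
  obtain b' where b': "b' \<in> U t" "b = ginv G b'"
    using a(2) t by (auto simp: rep_minv)
  have arr: "b' \<in> arrows G" "c \<in> arrows G"
    using b' f t rep_arrows by auto
  have "rg G b' = rg G c"
    using f(3) a(3,4) b'(2) arr by (simp add: composable_def dm_cmp dm_ginv)
  then have c: "c = b'"
    using rep_bisection_rg[OF t b'(1) f(2)] by simp
  have "composable G b c"
    using arr by (simp add: c b'(2) composable_def ginv_arrows dm_ginv)
  then have "k = a \<cdot> (b \<cdot> c)"
    using a(3,4) f(4) by (simp add: cmp_assoc)
  also have "b \<cdot> c = dm G a"
    using arr a(3) b'(2) by (simp add: c ginv_cmp composable_def rg_ginv)
  finally have "k = a"
    using a(3) cmp_dm[of a] by (simp add: composable_def)
  moreover have "dm G a = dm G b'"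
    using arr a(3) b'(2) by (simp add: composable_def rg_ginv)
  ultimately show "k \<in> {k \<in> U s. dm G k \<in> dm G ` U t}"
    using a(1) b'(1) by auto
qed

lemma rep_cancel:
  assumes "s \<in> carrier S" "t \<in> carrier S" "U t \<subseteq> U s"
  shows "U (s \<otimes>\<^bsub>S\<^esub> minv S t \<otimes>\<^bsub>S\<^esub> t) = U t"
proof (intro equalityI subsetI)
  fix k assume "k \<in> U (s \<otimes>\<^bsub>S\<^esub> minv S t \<otimes>\<^bsub>S\<^esub> t)"
  then obtain c where "k \<in> U s" "c \<in> U t" "dm G k = dm G c"
    using rep_cancel_subset[OF assms(1,2)] by blast
  then show "k \<in> U t"
    using assms(3) rep_bisection[OF assms(1)] by (auto simp: inj_on_def)
next
  fix g assume g: "g \<in> U t"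
  then have arr: "g \<in> arrows G"
    using assms rep_arrows by auto
  have c: "composable G g (ginv G g)"
    using arr by (simp add: composable_def ginv_arrows rg_ginv)
  have "g \<cdot> ginv G g \<in> U (s \<otimes>\<^bsub>S\<^esub> minv S t)"
    using assms(1,2) g arr minv_closed subsetD[OF assms(3) g]
    by (intro rep_multI) (simp_all add: rep_minv rg_ginv)
  then have "(g \<cdot> ginv G g) \<cdot> g \<in> U (s \<otimes>\<^bsub>S\<^esub> minv S t \<otimes>\<^bsub>S\<^esub> t)"
    using assms g arr c minv_closed[of t]
    by (intro rep_multI[OF mult_closed]) (auto simp: dm_cmp dm_ginv)
  then show "g \<in> U (s \<otimes>\<^bsub>S\<^esub> minv S t \<otimes>\<^bsub>S\<^esub> t)"
    using arr by (simp add: cmp_ginv rg_cmp_self)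
qed

lemma rep_mono:
  assumes "s \<in> carrier S" "t \<in> carrier S" "nat_le S s t"
  shows "U s \<subseteq> U t"
  using rep_cancel_subset[OF assms(2,1)] assms(3) unfolding nat_le_def by auto


subsection \<open>The topology\<close>

lemma openin_rep: "s \<in> carrier S \<Longrightarrow> openin (gtop G) (U s)"
  by (simp add: rep_gtop topology_generated_by_Basis)

lemma topspace_rep: "topspace (gtop G) = arrows G"
  using rep_subset rep_cover by (auto simp: rep_gtop)

lemma rep_base:
  assumes "openin (gtop G) V" "g \<in> V"
  shows "\<exists>s\<in>carrier S. g \<in> U s \<and> U s \<subseteq> V"
proof -
  have "generate_topology_on (U ` carrier S) V"
    using assms(1) by (simp add: rep_gtop openin_topology_generated_by_iff)
  then show ?thesis
    using assms(2)
  proof (induction arbitrary: g)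
    case (Int V W)
    obtain s t where s: "s \<in> carrier S" "g \<in> U s" "U s \<subseteq> V"
      and t: "t \<in> carrier S" "g \<in> U t" "U t \<subseteq> W"
      using Int.IH(1)[of g] Int.IH(2)[of g] Int.prems by auto
    obtain r where r: "r \<in> carrier S" "g \<in> U r" "nat_le S r s" "nat_le S r t"
      using rep_meet[OF s(1) t(1) s(2) t(2)] by auto
    then have "U r \<subseteq> U s" "U r \<subseteq> U t"
      using s t rep_mono by auto
    with r s t show ?case
      by blast
  next
    case (UN K)
    then obtain V where V: "V \<in> K" "g \<in> V" by auto
    then obtain s where "s \<in> carrier S" "g \<in> U s" "U s \<subseteq> V"
      using UN.IH by blast
    with V show ?case by blast
  qed auto
qed

text \<open>Continuity of the product: if \<open>g \<cdot> h \<in> U s\<close> and \<open>h \<in> U t\<close>, the neighbourhoods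
  \<open>U (s \<otimes> t\<inverse>)\<close> of \<open>g\<close> and \<open>U t\<close> of \<open>h\<close> have their product inside \<open>U s\<close>.\<close>

lemma rep_split:
  assumes s: "s \<in> carrier S" and gh: "composable G g h" "g \<cdot> h \<in> U s"
  obtains r t where "r \<in> carrier S" "t \<in> carrier S" "g \<in> U r" "h \<in> U t" "U (r \<otimes>\<^bsub>S\<^esub> t) \<subseteq> U s"
proof -
  have arr: "g \<in> arrows G" "h \<in> arrows G" "dm G g = rg G h"
    using gh by (auto simp: composable_def)
  obtain t where t: "t \<in> carrier S" "h \<in> U t"
    using rep_cover arr by blast
  have "(g \<cdot> h) \<cdot> ginv G h \<in> U (s \<otimes>\<^bsub>S\<^esub> minv S t)"
    using arr gh s t by (intro rep_multI) (auto simp: minv_closed rep_minvI dm_cmp rg_ginv)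
  then have "g \<in> U (s \<otimes>\<^bsub>S\<^esub> minv S t)"
    by (simp add: cmp_ginv_cancel gh)
  then show ?thesis
    using that[of "s \<otimes>\<^bsub>S\<^esub> minv S t" t] rep_cancel_subset[OF s t(1)] s t
    by (auto simp: mult_closed minv_closed)
qed

lemma topological: "topological_groupoid G"
proof
  show "topspace (gtop G) = arrows G"
    by (rule topspace_rep)
  have sub: "\<Union> (U ` carrier S) = arrows G"
    using rep_subset rep_cover by auto
  have "continuous_map (gtop G) (topology_generated_by (U ` carrier S)) (ginv G)"
  proof (rule continuous_on_generated_topo)
    fix V assume "V \<in> U ` carrier S"
    then obtain s where s: "s \<in> carrier S" "V = U s" by auto
    have "ginv G -` U s \<inter> arrows G = U (minv S s)"
      using s(1) rep_arrows by (force simp: rep_minv ginv_ginv ginv_arrows)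
    then show "openin (gtop G) (ginv G -` V \<inter> topspace (gtop G))"
      using s by (simp add: topspace_rep openin_rep minv_closed)
  qed (use sub in \<open>auto simp: topspace_rep ginv_arrows\<close>)
  then show "continuous_map (gtop G) (gtop G) (ginv G)"
    by (simp add: rep_gtop)
  let ?P = "subtopology (prod_topology (gtop G) (gtop G)) {(a, b). composable G a b}"
  have "continuous_map ?P (topology_generated_by (U ` carrier S)) (\<lambda>(a, b). a \<cdot> b)"
  proof (rule continuous_on_generated_topo)
    fix V assume "V \<in> U ` carrier S"
    then obtain s where s: "s \<in> carrier S" "V = U s" by auto
    let ?W = "(\<lambda>(a, b). a \<cdot> b) -` V \<inter> topspace ?P"
    show "openin ?P ?W"
    proof (subst openin_subopen, intro ballI)
      fix p assume p: "p \<in> ?W"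
      obtain g h where gh: "p = (g, h)" by fastforce
      have gh': "composable G g h" "g \<cdot> h \<in> U s"
        using p gh s by auto
      obtain r t where rt: "r \<in> carrier S" "t \<in> carrier S" "g \<in> U r" "h \<in> U t"
          "U (r \<otimes>\<^bsub>S\<^esub> t) \<subseteq> U s"
        using rep_split[OF s(1) gh'] by blast
      let ?T = "(U r \<times> U t) \<inter> {(a, b). composable G a b}"
      have "openin ?P ?T"
        by (auto simp: openin_subtopology openin_prod_Times_iff rt openin_rep
          intro!: exI[of _ "U r \<times> U t"])
      moreover have "p \<in> ?T"
        using gh gh' rt by auto
      moreover have "?T \<subseteq> ?W"
        using rt rep_multI[OF rt(1,2)] rep_arrows s(2)
        by (fastforce simp: topspace_rep composable_def)
      ultimately show "\<exists>T. openin ?P T \<and> p \<in> T \<and> T \<subseteq> ?W"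
        by blast
    qed
  qed (auto simp: sub topspace_rep cmp_arrows)
  then show "continuous_map ?P (gtop G) (\<lambda>(a, b). a \<cdot> b)"
    by (simp add: rep_gtop)
qed

lemma dm_image_rep:
  assumes "s \<in> carrier S"
  shows "dm G ` U s = U (minv S s \<otimes>\<^bsub>S\<^esub> s)"
proof (intro equalityI subsetI)
  fix k assume "k \<in> dm G ` U s"
  then obtain g where g: "g \<in> U s" "k = dm G g" by auto
  then have "ginv G g \<cdot> g \<in> U (minv S s \<otimes>\<^bsub>S\<^esub> s)"
    using assms rep_arrows by (intro rep_multI) (auto simp: minv_closed rep_minvI dm_ginv)
  then show "k \<in> U (minv S s \<otimes>\<^bsub>S\<^esub> s)"
    using g assms rep_arrows by (auto simp: ginv_cmp)
next
  fix k assume "k \<in> U (minv S s \<otimes>\<^bsub>S\<^esub> s)"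
  then obtain h g where *: "h \<in> U (minv S s)" "g \<in> U s" "composable G h g" "k = h \<cdot> g"
    using rep_multE[of "minv S s" s k] assms by (auto intro: minv_closed)
  obtain h' where h': "h' \<in> U s" "h = ginv G h'"
    using * assms by (auto simp: rep_minv)
  have "rg G h' = rg G g"
    using * h' assms rep_arrows by (auto simp: composable_def dm_ginv)
  then have "h' = g"
    using rep_bisection_rg assms * h' by blast
  then show "k \<in> dm G ` U s"
    using * h' assms rep_arrows by (auto simp: ginv_cmp)
qed

lemma open_map_dm: "open_map (gtop G) (gtop G) (dm G)"
  unfolding open_map_def
proof (intro allI impI)
  fix V assume V: "openin (gtop G) V"
  show "openin (gtop G) (dm G ` V)"
  proof (subst openin_subopen, intro ballI)
    fix e assume "e \<in> dm G ` V"
    then obtain g where g: "g \<in> V" "e = dm G g" by auto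
    obtain s where s: "s \<in> carrier S" "g \<in> U s" "U s \<subseteq> V"
      using rep_base[OF V g(1)] by blast
    have "openin (gtop G) (dm G ` U s)"
      using s by (simp add: dm_image_rep openin_rep minv_closed mult_closed)
    with s g show "\<exists>T. openin (gtop G) T \<and> e \<in> T \<and> T \<subseteq> dm G ` V"
      by blast
  qed
qed

lemma continuous_map_dm: "continuous_map (gtop G) (gtop G) (dm G)"
proof -
  interpret topological_groupoid G by (rule topological)
  let ?P = "subtopology (prod_topology (gtop G) (gtop G)) {(a, b). composable G a b}"
  have "continuous_map (gtop G) (prod_topology (gtop G) (gtop G)) (\<lambda>a. (ginv G a, a))"
    by (simp add: continuous_map_pairedI continuous_ginv)
  then have "continuous_map (gtop G) ?P (\<lambda>a. (ginv G a, a))"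
    by (rule continuous_map_into_subtopology)
       (auto simp: composable_def topspace_rep ginv_arrows dm_ginv)
  from continuous_map_compose[OF this continuous_cmp]
  show ?thesis
    by (rule continuous_map_eq) (simp add: topspace_rep ginv_cmp)
qed

lemma etale: "etale_groupoid G"
proof -
  interpret topological_groupoid G by (rule topological)
  show ?thesis
  proof
    fix a assume "a \<in> arrows G"
    then obtain s where s: "s \<in> carrier S" "a \<in> U s"
      using rep_cover by blast
    let ?D = "dm G ` U s"
    have oD: "openin (gtop G) ?D"
      using s by (simp add: dm_image_rep openin_rep minv_closed mult_closed)
    have D: "?D \<subseteq> arrows G" "?D \<subseteq> idents G"
      using s rep_arrows dm_arrows dm_idents by auto
    have sub: "U s \<subseteq> arrows G"
      using s rep_subset by auto
    have "homeomorphic_map (subtopology (gtop G) (U s)) (subtopology (gtop G) ?D) (dm G)"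
    proof (rule bijective_open_imp_homeomorphic_map)
      show "continuous_map (subtopology (gtop G) (U s)) (subtopology (gtop G) ?D) (dm G)"
        by (intro continuous_map_into_subtopology continuous_map_from_subtopology
            continuous_map_dm) auto
      show "open_map (subtopology (gtop G) (U s)) (subtopology (gtop G) ?D) (dm G)"
        using s open_map_dm oD openin_rep
        by (auto simp: open_map_def openin_open_subtopology)
      show "dm G ` topspace (subtopology (gtop G) (U s)) = topspace (subtopology (gtop G) ?D)"
        using sub D by (auto simp: topspace_rep)
      show "inj_on (dm G) (topspace (subtopology (gtop G) (U s)))"
        using rep_bisection[OF s(1)] by (auto simp: inj_on_def)
    qed
    moreover have "openin (subtopology (gtop G) (idents G)) ?D"
      using oD D(2) by (auto simp: openin_subtopology)
    ultimately show "\<exists>V. openin (gtop G) V \<and> a \<in> V \<and>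
        openin (subtopology (gtop G) (idents G)) (dm G ` V) \<and>
        homeomorphic_map (subtopology (gtop G) V) (subtopology (gtop G) (dm G ` V)) (dm G)"
      using s openin_rep by blast
  qed
qed



subsection \<open>The quotient by the Lenz congruence\<close>

text \<open>The Lenz congruence is the kernel of \<open>U\<close>. If \<open>g \<in> U s\<close> is not in \<open>U t\<close>, some element
  below \<open>s\<close> is represented by a neighbourhood of \<open>g\<close> disjoint from \<open>U t\<close> and meets nothing
  non-zero below \<open>t\<close>; conversely, if \<open>U s \<subseteq> U t\<close> and \<open>0 \<noteq> x \<le> s\<close>, then \<open>x\<close> and \<open>t\<close> have a
  common non-zero lower bound at every point of \<open>U x\<close>.\<close>

lemma lenz_half_iff:
  assumes s: "s \<in> carrier S" and t: "t \<in> carrier S"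
  shows "lenz_half S s t \<longleftrightarrow> U s \<subseteq> U t"
proof
  assume half: "lenz_half S s t"
  show "U s \<subseteq> U t"
  proof (rule subsetI, rule ccontr)
    fix g assume g: "g \<in> U s" "g \<notin> U t"
    then obtain r where r: "r \<in> carrier S" "g \<in> U r" "U r \<inter> U t = {}"
      using rep_clopen[OF t] rep_arrows[OF s] by blast
    obtain x where x: "x \<in> carrier S" "g \<in> U x" "nat_le S x s" "nat_le S x r"
      using rep_meet[OF s r(1) g(1) r(2)] by blast
    have "x \<noteq> mzero S"
      using x(2) rep_mzero by auto
    then obtain z where z: "z \<in> carrier S" "z \<noteq> mzero S" "nat_le S z x" "nat_le S z t"
      using half x unfolding lenz_half_def by blast
    have "U z \<subseteq> U r \<inter> U t"
      using rep_mono x z r(1) t by blast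
    then show False
      using rep_nonempty[OF z(1,2)] r(3) by blast
  qed
next
  assume sub: "U s \<subseteq> U t"
  show "lenz_half S s t"
    unfolding lenz_half_def
  proof (intro ballI impI, elim conjE)
    fix x assume x: "x \<in> carrier S" "x \<noteq> mzero S" "nat_le S x s"
    then obtain g where g: "g \<in> U x"
      using rep_nonempty by blast
    then have "g \<in> U t"
      using rep_mono x s sub by blast
    then obtain z where "z \<in> carrier S" "g \<in> U z" "nat_le S z x" "nat_le S z t"
      using rep_meet[OF x(1) t g] by blast
    moreover from this have "z \<noteq> mzero S"
      using rep_mzero by auto
    ultimately show "\<exists>z\<in>carrier S. z \<noteq> mzero S \<and> nat_le S z x \<and> nat_le S z t"
      by blast
  qed
qed

lemma lenz_eq: "lenz S = {(s, t). s \<in> carrier S \<and> t \<in> carrier S \<and> U s = U t}"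
  unfolding lenz_def using lenz_half_iff by blast

lemma lenz_class: "s \<in> carrier S \<Longrightarrow> lenz S `` {s} = {t \<in> carrier S. U t = U s}"
  by (auto simp: lenz_eq)

lemma lenz_class_cong:
  "s \<in> carrier S \<Longrightarrow> t \<in> carrier S \<Longrightarrow> U s = U t \<Longrightarrow> lenz S `` {s} = lenz S `` {t}"
  by (simp add: lenz_class)

text \<open>All members of a class of the Lenz congruence have the same representing set, which is
  therefore the union below.\<close>

definition class_rep :: "'a set \<Rightarrow> 'g set" where
  "class_rep X = \<Union> (U ` X)"

lemma class_rep: "s \<in> carrier S \<Longrightarrow> class_rep (lenz S `` {s}) = U s"
  by (auto simp: class_rep_def lenz_class)

lemma lenz_quotient_carrier: "carrier (lenz_quotient S) = (\<lambda>s. lenz S `` {s}) ` carrier S"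
  by (auto simp: lenz_quotient_def quotient_def)

lemma UN_constant_class: "(\<And>x. x \<in> A \<Longrightarrow> f x = c) \<Longrightarrow> a \<in> A \<Longrightarrow> (\<Union>x\<in>A. f x) = c"
  by blast

lemma lenz_quotient_mult:
  assumes "s \<in> carrier S" "t \<in> carrier S"
  shows "lenz S `` {s} \<otimes>\<^bsub>lenz_quotient S\<^esub> lenz S `` {t} = lenz S `` {s \<otimes>\<^bsub>S\<^esub> t}"
proof -
  have "lenz S `` {x \<otimes>\<^bsub>S\<^esub> y} = lenz S `` {s \<otimes>\<^bsub>S\<^esub> t}" if "x \<in> lenz S `` {s}" "y \<in> lenz S `` {t}" for x y
    using that assms by (intro lenz_class_cong) (auto simp: lenz_class mult_closed rep_mult)
  moreover have "s \<in> lenz S `` {s}" "t \<in> lenz S `` {t}"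
    using assms by (auto simp: lenz_class)
  ultimately have "(\<Union>x\<in>lenz S `` {s}. \<Union>y\<in>lenz S `` {t}. lenz S `` {x \<otimes>\<^bsub>S\<^esub> y}) =
      lenz S `` {s \<otimes>\<^bsub>S\<^esub> t}"
    by (metis (no_types, lifting) UN_constant_class)
  then show ?thesis
    by (simp add: lenz_quotient_def)
qed

lemma lenz_quotient_minv:
  assumes "s \<in> carrier S"
  shows "minv (lenz_quotient S) (lenz S `` {s}) = lenz S `` {minv S s}"
proof -
  have "lenz S `` {minv S x} = lenz S `` {minv S s}" if "x \<in> lenz S `` {s}" for x
    using that assms by (intro lenz_class_cong) (auto simp: lenz_class minv_closed rep_minv)
  moreover have "s \<in> lenz S `` {s}"
    using assms by (auto simp: lenz_class)
  ultimately have "(\<Union>x\<in>lenz S `` {s}. lenz S `` {minv S x}) = lenz S `` {minv S s}"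
    by (rule UN_constant_class)
  then show ?thesis
    by (simp add: lenz_quotient_def)
qed

lemma lenz_quotient_mzero: "mzero (lenz_quotient S) = lenz S `` {mzero S}"
  by (simp add: lenz_quotient_def)

lemma nat_le_quotient:
  assumes "s \<in> carrier S" "t \<in> carrier S" "nat_le S s t"
  shows "nat_le (lenz_quotient S) (lenz S `` {s}) (lenz S `` {t})"
  using assms unfolding nat_le_def
  by (simp add: lenz_quotient_mult lenz_quotient_minv minv_closed mult_closed)

end

text \<open>Injectivity turns the natural partial order of \<open>S\<close> into inclusion of the representing sets,
  so that filters of \<open>S\<close> become filters of bisections.\<close>

locale faithful_bisection_representation = bisection_representation G S U
  for G :: "('g, 'n) groupoid_space_scheme" (structure)
    and S :: "('a, 'm) inverse_monoid_scheme"
    and U :: "'a \<Rightarrow> 'g set" +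
  assumes rep_inj: "s \<in> carrier S \<Longrightarrow> t \<in> carrier S \<Longrightarrow> U s = U t \<Longrightarrow> s = t"

lemma (in bisection_representation) lenz_quotient_representation:
  "faithful_bisection_representation G (lenz_quotient S) class_rep"
proof
  fix X Y assume "X \<in> carrier (lenz_quotient S)" "Y \<in> carrier (lenz_quotient S)"
  then obtain s t where s: "s \<in> carrier S" "X = lenz S `` {s}"
    and t: "t \<in> carrier S" "Y = lenz S `` {t}"
    by (auto simp: lenz_quotient_carrier)
  show "X \<otimes>\<^bsub>lenz_quotient S\<^esub> Y \<in> carrier (lenz_quotient S)"
    using s t by (auto simp: lenz_quotient_mult lenz_quotient_carrier mult_closed)
  show "class_rep (X \<otimes>\<^bsub>lenz_quotient S\<^esub> Y) = set_cmp G (class_rep X) (class_rep Y)"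
    using s t by (simp add: lenz_quotient_mult class_rep mult_closed rep_mult)
  show "\<exists>Z\<in>carrier (lenz_quotient S). g \<in> class_rep Z \<and>
      nat_le (lenz_quotient S) Z X \<and> nat_le (lenz_quotient S) Z Y"
    if g: "g \<in> class_rep X" "g \<in> class_rep Y" for g
  proof -
    have "g \<in> U s" "g \<in> U t"
      using g s t by (simp_all add: class_rep)
    then obtain r where r: "r \<in> carrier S" "g \<in> U r" "nat_le S r s" "nat_le S r t"
      using rep_meet s t by blast
    show ?thesis
      using r s t by (intro bexI[of _ "lenz S `` {r}"])
        (auto simp: class_rep nat_le_quotient lenz_quotient_carrier)
  qed
  show "X = Y" if "class_rep X = class_rep Y"
    using that s t lenz_class_cong[of s t] by (simp add: class_rep)
next
  fix X assume "X \<in> carrier (lenz_quotient S)"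
  then obtain s where s: "s \<in> carrier S" "X = lenz S `` {s}"
    by (auto simp: lenz_quotient_carrier)
  show "minv (lenz_quotient S) X \<in> carrier (lenz_quotient S)"
    using s by (auto simp: lenz_quotient_minv lenz_quotient_carrier minv_closed)
  show "class_rep X \<subseteq> arrows G"
    using s by (simp add: class_rep rep_subset)
  show "class_rep (minv (lenz_quotient S) X) = ginv G ` class_rep X"
    using s by (simp add: lenz_quotient_minv class_rep minv_closed rep_minv)
  show "class_rep X \<noteq> {}" if "X \<noteq> mzero (lenz_quotient S)"
    using that s rep_nonempty[of s] by (auto simp: class_rep lenz_quotient_mzero)
  show "inj_on (dm G) (class_rep X)"
    using s by (simp add: class_rep rep_bisection)
  show "\<exists>Y\<in>carrier (lenz_quotient S). g \<in> class_rep Y \<and> class_rep Y \<inter> class_rep X = {}"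
    if g: "g \<in> arrows G" "g \<notin> class_rep X" for g
  proof -
    obtain t where "t \<in> carrier S" "g \<in> U t" "U t \<inter> U s = {}"
      using rep_clopen[OF s(1)] g s by (auto simp: class_rep)
    then show ?thesis
      using s by (intro bexI[of _ "lenz S `` {t}"]) (auto simp: class_rep lenz_quotient_carrier)
  qed
next
  show "mzero (lenz_quotient S) \<in> carrier (lenz_quotient S)"
    by (auto simp: lenz_quotient_mzero lenz_quotient_carrier mzero_closed)
  show "class_rep (mzero (lenz_quotient S)) = {}"
    by (simp add: lenz_quotient_mzero class_rep mzero_closed rep_mzero)
  have img: "class_rep ` carrier (lenz_quotient S) = U ` carrier S"
    unfolding lenz_quotient_carrier image_image by (intro image_cong refl class_rep)
  show "gtop G = topology_generated_by (class_rep ` carrier (lenz_quotient S))"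
    by (simp add: img rep_gtop)
  show "\<exists>X\<in>carrier (lenz_quotient S). g \<in> class_rep X" if "g \<in> arrows G" for g
    using rep_cover[OF that] by (auto simp: lenz_quotient_carrier class_rep)
  show "g = h" if "g \<in> arrows G" "h \<in> arrows G"
    and le: "\<And>X. X \<in> carrier (lenz_quotient S) \<Longrightarrow> g \<in> class_rep X \<Longrightarrow> h \<in> class_rep X" for g h
  proof (rule rep_separated)
    show "h \<in> U s" if "s \<in> carrier S" "g \<in> U s" for s
      using le[of "lenz S `` {s}"] that by (auto simp: lenz_quotient_carrier class_rep)
  qed (use that in auto)
next
  fix D assume D: "D \<subseteq> carrier (lenz_quotient S)" "D \<noteq> {}"
    and ne: "\<And>X. X \<in> D \<Longrightarrow> class_rep X \<noteq> {}"
    and dir: "\<And>X Y. X \<in> D \<Longrightarrow> Y \<in> D \<Longrightarrow> \<exists>Z\<in>D. class_rep Z \<subseteq> class_rep X \<inter> class_rep Y"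
  have rep: "\<exists>s\<in>carrier S. X = lenz S `` {s} \<and> class_rep X = U s" if "X \<in> D" for X
    using subsetD[OF D(1) that] by (auto simp: lenz_quotient_carrier class_rep)
  let ?D = "{s \<in> carrier S. lenz S `` {s} \<in> D}"
  have "\<exists>g. \<forall>s\<in>?D. g \<in> U s"
  proof (rule rep_compact)
    show "?D \<noteq> {}"
      using D(2) rep by blast
    show "U s \<noteq> {}" if "s \<in> ?D" for s
      using ne[of "lenz S `` {s}"] that by (simp add: class_rep)
    show "\<exists>r\<in>?D. U r \<subseteq> U s \<inter> U t" if "s \<in> ?D" "t \<in> ?D" for s t
    proof -
      have st: "s \<in> carrier S" "t \<in> carrier S" "lenz S `` {s} \<in> D" "lenz S `` {t} \<in> D"
        using that by auto
      obtain Z where "Z \<in> D" "class_rep Z \<subseteq> U s \<inter> U t"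
        using dir[OF st(3,4)] st(1,2) by (auto simp: class_rep)
      then show ?thesis
        using rep[of Z] by auto
    qed
  qed auto
  then obtain g where g: "\<And>s. s \<in> ?D \<Longrightarrow> g \<in> U s"
    by blast
  have "g \<in> class_rep X" if "X \<in> D" for X
    using rep[OF that] that g by auto
  then show "\<exists>g. \<forall>X\<in>D. g \<in> class_rep X"
    by blast
qed


section \<open>Points and ultrafilters\<close>

context faithful_bisection_representation
begin

lemma nat_le_iff:
  assumes "s \<in> carrier S" "t \<in> carrier S"
  shows "nat_le S s t \<longleftrightarrow> U s \<subseteq> U t"
proof
  assume "U s \<subseteq> U t"
  then have "U s = U (t \<otimes>\<^bsub>S\<^esub> minv S s \<otimes>\<^bsub>S\<^esub> s)"
    using assms by (simp add: rep_cancel)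
  then show "nat_le S s t"
    unfolding nat_le_def using assms by (intro rep_inj) (auto simp: mult_closed minv_closed)
qed (use assms rep_mono in blast)

definition point :: "'g \<Rightarrow> 'a set" where
  "point g = {s \<in> carrier S. g \<in> U s}"

lemma proper_filter_point:
  assumes "g \<in> arrows G"
  shows "proper_filter S (point g)"
proof -
  have "\<exists>r\<in>point g. nat_le S r s \<and> nat_le S r t" if "s \<in> point g" "t \<in> point g" for s t
    using that rep_meet by (fastforce simp: point_def)
  moreover have "point g \<noteq> {}"
    using rep_cover assms by (auto simp: point_def)
  ultimately show ?thesis
    unfolding proper_filter_def is_filter_def
    using rep_mzero by (auto simp: point_def dest: subsetD[OF rep_mono, rotated -1])
qed

text \<open>A proper filter is a downward directed family of non-empty compact sets, hence has a common
  point.\<close>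

lemma proper_filter_below_point:
  assumes "proper_filter S F"
  obtains g where "g \<in> arrows G" "F \<subseteq> point g"
proof -
  have F: "F \<subseteq> carrier S" "F \<noteq> {}" "mzero S \<notin> F"
    "\<And>s t. s \<in> F \<Longrightarrow> t \<in> F \<Longrightarrow> \<exists>r\<in>F. nat_le S r s \<and> nat_le S r t"
    using assms unfolding proper_filter_def is_filter_def by auto
  have "\<exists>g. \<forall>s\<in>F. g \<in> U s"
  proof (rule rep_compact[OF F(1,2)])
    show "U s \<noteq> {}" if "s \<in> F" for s
      using that F(1,3) rep_nonempty by blast
    show "\<exists>r\<in>F. U r \<subseteq> U s \<inter> U t" if "s \<in> F" "t \<in> F" for s t
      using F(4)[OF that] that F(1) nat_le_iff by (metis le_inf_iff subsetD)
  qed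
  then obtain g where g: "\<forall>s\<in>F. g \<in> U s" by blast
  with F have "g \<in> arrows G" "F \<subseteq> point g"
    using rep_arrows by (auto simp: point_def)
  then show ?thesis by (rule that)
qed

lemma point_subsetD: "g \<in> arrows G \<Longrightarrow> h \<in> arrows G \<Longrightarrow> point g \<subseteq> point h \<Longrightarrow> g = h"
  by (rule rep_separated) (auto simp: point_def)

text \<open>A proper filter containing \<open>point g\<close> lies below some \<open>point h\<close>, and the filters of two
  distinct points are incomparable.\<close>

lemma ultrafilter_point:
  assumes "g \<in> arrows G"
  shows "is_ultrafilter S (point g)"
  unfolding is_ultrafilter_def
proof (intro conjI allI impI)
  show "proper_filter S (point g)"
    using assms by (rule proper_filter_point)
  fix F assume F: "proper_filter S F \<and> point g \<subseteq> F"
  then obtain h where h: "h \<in> arrows G" "F \<subseteq> point h"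
    using proper_filter_below_point by metis
  with F assms have "g = h"
    by (intro point_subsetD) auto
  with F h show "F = point g"
    by auto
qed

lemma ultrafilters_eq: "{A. is_ultrafilter S A} = point ` arrows G"
proof (intro equalityI subsetI)
  fix A assume "A \<in> {A. is_ultrafilter S A}"
  then have A: "proper_filter S A" "\<And>F. proper_filter S F \<Longrightarrow> A \<subseteq> F \<Longrightarrow> F = A"
    unfolding is_ultrafilter_def by auto
  obtain g where g: "g \<in> arrows G" "A \<subseteq> point g"
    using A(1) by (rule proper_filter_below_point)
  then show "A \<in> point ` arrows G"
    using A(2)[OF proper_filter_point] by blast
qed (auto simp: ultrafilter_point)

lemma inj_point: "inj_on point (arrows G)"
  by (intro inj_onI point_subsetD) auto

lemma point_ginv:
  assumes "g \<in> arrows G"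
  shows "minv S ` point g = point (ginv G g)"
proof -
  have sub: "minv S s \<in> point (ginv G h)" if "s \<in> point h" for s h
    using that by (auto simp: point_def minv_closed rep_minvI)
  show ?thesis
  proof (intro equalityI subsetI)
    fix s assume s: "s \<in> point (ginv G g)"
    then have c: "s \<in> carrier S"
      by (simp add: point_def)
    have "U (minv S (minv S s)) = U s"
      using c rep_arrows by (force simp: rep_minv minv_closed image_image ginv_ginv)
    then have "s = minv S (minv S s)"
      using c by (intro rep_inj) (auto simp: minv_closed)
    moreover have "minv S s \<in> point g"
      using sub[OF s] assms by (simp add: ginv_ginv)
    ultimately show "s \<in> minv S ` point g"
      by blast
  qed (use sub in auto)
qed

lemma point_cmp:
  assumes "composable G g h"
  shows "up_closure S (subset_prod S (point g) (point h)) = point (g \<cdot> h)"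
proof (intro equalityI subsetI)
  fix b assume "b \<in> up_closure S (subset_prod S (point g) (point h))"
  then obtain s t where b: "b \<in> carrier S" "s \<in> point g" "t \<in> point h" "nat_le S (s \<otimes>\<^bsub>S\<^esub> t) b"
    unfolding up_closure_def subset_prod_def by auto
  then have "U (s \<otimes>\<^bsub>S\<^esub> t) \<subseteq> U b"
    by (simp add: point_def mult_closed nat_le_iff)
  moreover have "g \<cdot> h \<in> U (s \<otimes>\<^bsub>S\<^esub> t)"
    using b assms by (intro rep_multI) (auto simp: point_def composable_def)
  ultimately show "b \<in> point (g \<cdot> h)"
    using b(1) by (auto simp: point_def)
next
  fix b assume "b \<in> point (g \<cdot> h)"
  then have b: "b \<in> carrier S" "g \<cdot> h \<in> U b"
    by (auto simp: point_def)
  obtain s t where "s \<in> carrier S" "t \<in> carrier S" "g \<in> U s" "h \<in> U t" "U (s \<otimes>\<^bsub>S\<^esub> t) \<subseteq> U b"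
    using rep_split[OF b(1) assms b(2)] .
  then show "b \<in> up_closure S (subset_prod S (point g) (point h))"
    using b(1) nat_le_iff[of "s \<otimes>\<^bsub>S\<^esub> t" b] unfolding up_closure_def subset_prod_def point_def
    by (auto simp: mult_closed)
qed

lemma point_dm:
  assumes "g \<in> arrows G"
  shows "up_closure S (subset_prod S (minv S ` point g) (point g)) = point (dm G g)"
  using assms point_cmp[of "ginv G g" g]
  by (simp add: point_ginv composable_def ginv_arrows dm_ginv ginv_cmp)

lemma point_rg:
  assumes "g \<in> arrows G"
  shows "up_closure S (subset_prod S (point g) (minv S ` point g)) = point (rg G g)"
  using assms point_cmp[of g "ginv G g"]
  by (simp add: point_ginv composable_def ginv_arrows rg_ginv cmp_ginv)

lemma homeomorphic_map_point:
  "homeomorphic_map (gtop G) (gtop (ultrafilter_groupoid S)) point"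
proof -
  let ?B = "\<lambda>s. {A. is_ultrafilter S A \<and> s \<in> A}"
  have T: "gtop (ultrafilter_groupoid S) = topology_generated_by (?B ` carrier S)"
    by (simp add: ultrafilter_groupoid_def Setcompr_eq_image)
  have B: "?B s = point ` U s" if "s \<in> carrier S" for s
  proof -
    have "?B s = {A \<in> point ` arrows G. s \<in> A}"
      unfolding ultrafilters_eq[symmetric] by blast
    also have "\<dots> = point ` U s"
      using that rep_subset[OF that] by (auto simp: point_def)
    finally show ?thesis .
  qed
  have "\<Union> (?B ` carrier S) = (\<Union>s\<in>carrier S. point ` U s)"
    by (intro SUP_cong refl B)
  also have "\<dots> = point ` (\<Union>s\<in>carrier S. U s)"
    by (simp add: image_UN)
  also have "(\<Union>s\<in>carrier S. U s) = arrows G"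
    using rep_cover rep_subset by blast
  finally have img: "point ` arrows G = \<Union> (?B ` carrier S)"
    by simp
  show ?thesis
  proof (rule bijective_open_imp_homeomorphic_map)
    show "inj_on point (topspace (gtop G))"
      by (simp add: topspace_rep inj_point)
    show "point ` topspace (gtop G) = topspace (gtop (ultrafilter_groupoid S))"
      by (simp add: topspace_rep T img)
    show "continuous_map (gtop G) (gtop (ultrafilter_groupoid S)) point"
      unfolding T
    proof (rule continuous_on_generated_topo)
      fix V assume "V \<in> ?B ` carrier S"
      then obtain s where s: "s \<in> carrier S" "V = point ` U s"
        using B by blast
      have "point -` V \<inter> topspace (gtop G) = U s"
        using s inj_point rep_subset[OF s(1)] unfolding topspace_rep inj_on_def by blast
      then show "openin (gtop G) (point -` V \<inter> topspace (gtop G))"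
        using s by (simp add: openin_rep)
    qed (simp add: topspace_rep img)
    show "open_map (gtop G) (gtop (ultrafilter_groupoid S)) point"
      unfolding open_map_def
    proof (intro allI impI)
      fix V assume V: "openin (gtop G) V"
      show "openin (gtop (ultrafilter_groupoid S)) (point ` V)"
      proof (subst openin_subopen, intro ballI)
        fix A assume "A \<in> point ` V"
        then obtain g where g: "g \<in> V" "A = point g" by auto
        obtain s where s: "s \<in> carrier S" "g \<in> U s" "U s \<subseteq> V"
          using rep_base[OF V g(1)] by blast
        have "openin (gtop (ultrafilter_groupoid S)) (point ` U s)"
          unfolding T B[OF s(1), symmetric] using s by (intro topology_generated_by_Basis) auto
        with s g show "\<exists>W. openin (gtop (ultrafilter_groupoid S)) W \<and> A \<in> W \<and> W \<subseteq> point ` V"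
          by blast
      qed
    qed
  qed
qed

lemma isomorphism_point: "topological_groupoid_isomorphism G (ultrafilter_groupoid S) point"
  unfolding topological_groupoid_isomorphism_def
proof (intro conjI ballI allI impI)
  show "bij_betw point (arrows G) (arrows (ultrafilter_groupoid S))"
    by (simp add: bij_betw_def inj_point ultrafilter_groupoid_def ultrafilters_eq)
  show "homeomorphic_map (gtop G) (gtop (ultrafilter_groupoid S)) point"
    by (rule homeomorphic_map_point)
  show "point (ginv G a) = ginv (ultrafilter_groupoid S) (point a)" if "a \<in> arrows G" for a
    using that by (simp add: ultrafilter_groupoid_def point_ginv)
qed (simp_all add: ultrafilter_groupoid_def point_dm point_rg point_cmp)

end


section \<open>Transport along isomorphisms\<close>

lemma arrow_groupoid_transport:
  assumes "arrow_groupoid G" and iso: "topological_groupoid_isomorphism G H f"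
  shows "arrow_groupoid H"
proof -
  interpret arrow_groupoid G by fact
  have bij: "bij_betw f (arrows G) (arrows H)"
    and dm: "\<And>a. a \<in> arrows G \<Longrightarrow> dm H (f a) = f (dm G a)"
    and rg: "\<And>a. a \<in> arrows G \<Longrightarrow> rg H (f a) = f (rg G a)"
    and cmp: "\<And>a b. composable G a b \<Longrightarrow> cmp H (f a) (f b) = f (cmp G a b)"
    and ginv: "\<And>a. a \<in> arrows G \<Longrightarrow> ginv H (f a) = f (ginv G a)"
    using iso unfolding topological_groupoid_isomorphism_def by auto
  have inj: "f a = f b \<longleftrightarrow> a = b" if "a \<in> arrows G" "b \<in> arrows G" for a b
    using bij that by (auto simp: bij_betw_def inj_on_def)
  have arr: "arrows H = f ` arrows G"
    using bij by (simp add: bij_betw_def)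
  have id: "idents H = f ` idents G"
    by (simp add: idents_def arr dm image_image)
  have composableE: "\<exists>a b. x = f a \<and> y = f b \<and> composable G a b" if "composable H x y" for x y
  proof -
    have xy: "x \<in> f ` arrows G" "y \<in> f ` arrows G" "dm H x = rg H y"
      using that by (auto simp: composable_def arr)
    then obtain a b where ab: "a \<in> arrows G" "b \<in> arrows G" "x = f a" "y = f b"
      by blast
    then have "dm G a = rg G b"
      using xy(3) by (simp add: dm rg inj dm_arrows rg_arrows)
    with ab show ?thesis
      by (auto simp: composable_def)
  qed
  show ?thesis
  proof
    fix x y z assume "composable H x y" "composable H y z"
    then obtain a b b' c where *: "x = f a" "y = f b" "composable G a b" "y = f b'" "z = f c"
      "composable G b' c"
      by (metis composableE)
    then have "b' = b"
      by (metis inj composable_def)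
    then have c: "composable G b c"
      using * by simp
    show "cmp H (cmp H x y) z = cmp H x (cmp H y z)"
      using * c composable_cmp[OF *(3) c] by (simp add: cmp cmp_assoc)
  next
    fix x y assume "composable H x y"
    then obtain a b where *: "x = f a" "y = f b" "composable G a b"
      using composableE by blast
    then have "a \<in> arrows G" "b \<in> arrows G"
      by (simp_all add: composable_def)
    with * show "cmp H x y \<in> arrows H" "dm H (cmp H x y) = dm H y" "rg H (cmp H x y) = rg H x"
      by (simp_all add: cmp arr cmp_arrows dm rg dm_cmp rg_cmp)
  next
    fix x assume "x \<in> arrows H"
    then obtain a where a: "a \<in> arrows G" "x = f a"
      by (auto simp: arr)
    have "composable G a (dm G a)" "composable G (rg G a) a"
      "composable G (ginv G a) a" "composable G a (ginv G a)"
      using a(1) dm_arrows rg_arrows rg_ident[OF dm_idents] dm_ident[OF rg_idents]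
      by (simp_all add: composable_def ginv_arrows dm_ginv rg_ginv)
    with a show "cmp H x (dm H x) = x" "cmp H (rg H x) x = x"
      "cmp H (ginv H x) x = dm H x" "cmp H x (ginv H x) = rg H x"
      "ginv H x \<in> arrows H" "dm H (ginv H x) = rg H x" "rg H (ginv H x) = dm H x"
      "rg H x \<in> idents H"
      by (simp_all add: dm rg cmp ginv cmp_dm rg_cmp_self ginv_cmp cmp_ginv arr id ginv_arrows
          dm_ginv rg_ginv rg_idents)
  next
    fix x assume "x \<in> idents H"
    then obtain e where "e \<in> idents G" "x = f e"
      by (auto simp: id)
    then show "x \<in> arrows H" "dm H x = x" "rg H x = x"
      by (simp_all add: arr idents_arrows dm rg dm_ident rg_ident)
  qed
qed

lemma etale_groupoid_transport:
  assumes "etale_groupoid G" and iso: "topological_groupoid_isomorphism G H f"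
  shows "etale_groupoid H"
proof -
  interpret G: etale_groupoid G by fact
  interpret H: arrow_groupoid H
    using arrow_groupoid_transport[OF G.arrow_groupoid_axioms iso] .
  have bij: "bij_betw f (arrows G) (arrows H)"
    and dm: "\<And>a. a \<in> arrows G \<Longrightarrow> dm H (f a) = f (dm G a)"
    and rg: "\<And>a. a \<in> arrows G \<Longrightarrow> rg H (f a) = f (rg G a)"
    and cmp: "\<And>a b. composable G a b \<Longrightarrow> cmp H (f a) (f b) = f (cmp G a b)"
    and ginv: "\<And>a. a \<in> arrows G \<Longrightarrow> ginv H (f a) = f (ginv G a)"
    and homeo: "homeomorphic_map (gtop G) (gtop H) f"
    using iso unfolding topological_groupoid_isomorphism_def by auto
  have inj: "f a = f b \<longleftrightarrow> a = b" if "a \<in> arrows G" "b \<in> arrows G" for a b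
    using bij that by (auto simp: bij_betw_def inj_on_def)
  have arr: "arrows H = f ` arrows G"
    using bij by (simp add: bij_betw_def)
  have topH: "topspace (gtop H) = arrows H"
    using homeomorphic_imp_surjective_map[OF homeo] by (simp add: G.topspace_gtop arr)
  have id: "idents H = f ` idents G"
    by (simp add: idents_def arr dm image_image)
  obtain f' where "homeomorphic_maps (gtop G) (gtop H) f f'"
    using homeo homeomorphic_map_maps by blast
  then have cont: "continuous_map (gtop G) (gtop H) f" "continuous_map (gtop H) (gtop G) f'"
    and f': "\<And>a. a \<in> arrows G \<Longrightarrow> f' (f a) = a"
    and homeo': "homeomorphic_map (gtop H) (gtop G) f'"
    by (auto simp: homeomorphic_maps_def homeomorphic_map_maps G.topspace_gtop)
  let ?PG = "subtopology (prod_topology (gtop G) (gtop G)) {(a, b). composable G a b}"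
  let ?PH = "subtopology (prod_topology (gtop H) (gtop H)) {(a, b). composable H a b}"
  show ?thesis
  proof
    show "topspace (gtop H) = arrows H"
      by (rule topH)
    have "continuous_map (gtop H) (gtop H) (f \<circ> (ginv G \<circ> f'))"
      using cont G.continuous_ginv by (intro continuous_map_compose)
    then show "continuous_map (gtop H) (gtop H) (ginv H)"
      by (rule continuous_map_eq) (auto simp: topH arr f' ginv)
    have composable: "composable G a b" if "composable H (f a) (f b)" "a \<in> arrows G" "b \<in> arrows G"
      for a b
      using that by (simp add: composable_def dm rg inj G.dm_arrows G.rg_arrows)
    have "continuous_map ?PH (gtop G) (\<lambda>p. f' (fst p))" "continuous_map ?PH (gtop G) (\<lambda>p. f' (snd p))"
      using continuous_map_compose[OF continuous_map_fst cont(2)]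
        continuous_map_compose[OF continuous_map_snd cont(2)]
      by (auto simp: o_def intro!: continuous_map_from_subtopology)
    then have "continuous_map ?PH (prod_topology (gtop G) (gtop G)) (\<lambda>p. (f' (fst p), f' (snd p)))"
      by (rule continuous_map_pairedI)
    then have "continuous_map ?PH ?PG (\<lambda>p. (f' (fst p), f' (snd p)))"
      by (rule continuous_map_into_subtopology) (auto simp: topH arr f' composable)
    from continuous_map_compose[OF continuous_map_compose[OF this G.continuous_cmp] cont(1)]
    show "continuous_map ?PH (gtop H) (\<lambda>(a, b). cmp H a b)"
      by (rule continuous_map_eq) (auto simp: topH arr f' composable cmp)
  next
    fix x assume "x \<in> arrows H"
    then obtain a where a: "a \<in> arrows G" "x = f a"
      by (auto simp: arr)
    obtain V where V: "openin (gtop G) V" "a \<in> V"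
      "openin (subtopology (gtop G) (idents G)) (dm G ` V)"
      "homeomorphic_map (subtopology (gtop G) V) (subtopology (gtop G) (dm G ` V)) (dm G)"
      using G.local_homeomorphism_dm[OF a(1)] by blast
    have VG: "V \<subseteq> arrows G"
      using openin_subset[OF V(1)] by (simp add: G.topspace_gtop)
    have dV: "dm H ` f ` V = f ` dm G ` V"
      unfolding image_image using VG dm by (intro image_cong) auto
    have fV: "topspace (gtop H) \<inter> f ` V = f ` V" "topspace (gtop G) \<inter> V = V"
      "topspace (gtop H) \<inter> f ` dm G ` V = f ` dm G ` V" "topspace (gtop G) \<inter> dm G ` V = dm G ` V"
      using VG G.dm_arrows by (auto simp: topH arr G.topspace_gtop)
    have f'V: "f' ` f ` V = (\<lambda>x. x) ` V"
      unfolding image_image using VG f' by (intro image_cong) auto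
    have h1: "homeomorphic_map (subtopology (gtop H) (f ` V)) (subtopology (gtop G) V) f'"
      by (rule homeomorphic_map_subtopologies[OF homeo']) (simp add: fV f'V)
    have h2: "homeomorphic_map (subtopology (gtop G) (dm G ` V))
        (subtopology (gtop H) (f ` dm G ` V)) f"
      by (rule homeomorphic_map_subtopologies[OF homeo]) (simp add: fV)
    have "homeomorphic_map (subtopology (gtop H) (f ` V))
        (subtopology (gtop H) (f ` dm G ` V)) (f \<circ> (dm G \<circ> f'))"
      by (rule homeomorphic_map_compose[OF homeomorphic_map_compose[OF h1 V(4)] h2])
    then have "homeomorphic_map (subtopology (gtop H) (f ` V))
        (subtopology (gtop H) (dm H ` f ` V)) (dm H)"
      unfolding dV by (rule homeomorphic_map_eq) (use VG f' dm in \<open>auto simp: fV\<close>)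
    moreover have "openin (gtop H) (f ` V)"
      using homeomorphic_imp_open_map[OF homeo] V(1) by (simp add: open_map_def)
    moreover have "openin (subtopology (gtop H) (idents H)) (dm H ` f ` V)"
    proof -
      have "homeomorphic_map (subtopology (gtop G) (idents G)) (subtopology (gtop H) (idents H)) f"
        by (rule homeomorphic_map_subtopologies[OF homeo])
          (use G.idents_arrows in \<open>auto simp: topH arr id G.topspace_gtop\<close>)
      then show ?thesis
        unfolding dV using V(3) homeomorphic_imp_open_map by (auto simp: open_map_def)
    qed
    ultimately show "\<exists>W. openin (gtop H) W \<and> x \<in> W \<and>
        openin (subtopology (gtop H) (idents H)) (dm H ` W) \<and>
        homeomorphic_map (subtopology (gtop H) W) (subtopology (gtop H) (dm H ` W)) (dm H)"
      using V(2) a(2) by blast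
  qed
qed

theorem (in bisection_representation) etale_isomorphic_ultrafilter_groupoid:
  "etale_groupoid (ultrafilter_groupoid (lenz_quotient S))"
  "isomorphic_topological_groupoids G (ultrafilter_groupoid (lenz_quotient S))"
proof -
  interpret Q: faithful_bisection_representation G "lenz_quotient S" class_rep
    by (rule lenz_quotient_representation)
  show "etale_groupoid (ultrafilter_groupoid (lenz_quotient S))"
    using etale Q.isomorphism_point by (rule etale_groupoid_transport)
  show "isomorphic_topological_groupoids G (ultrafilter_groupoid (lenz_quotient S))"
    using Q.isomorphism_point unfolding isomorphic_topological_groupoids_def by blast
qed


section \<open>Initial segments of arrows\<close>

lemma le_add_vec: "(m :: nat ^ 'k::finite) \<le> m + n"
  by (simp add: less_eq_vec_def)

lemma add_diff_vec: "(m :: nat ^ 'k::finite) \<le> n \<Longrightarrow> m + (n - m) = n"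
  by (simp add: less_eq_vec_def vec_eq_iff)

lemma diff_add_vec: "(m + n) - m = (n :: nat ^ 'k::finite)"
  by (simp add: vec_eq_iff)

lemma finite_atMost_vec: "finite {m :: nat ^ 'k::finite. m \<le> n}"
proof (rule finite_subset)
  show "{m. m \<le> n} \<subseteq> vec_lambda ` (\<Pi>\<^sub>E i\<in>UNIV. {..n $ i})"
  proof
    fix m assume "m \<in> {m. m \<le> n}"
    then have "vec_nth m \<in> (\<Pi>\<^sub>E i\<in>UNIV. {..n $ i})"
      by (simp add: less_eq_vec_def PiE_def)
    then show "m \<in> vec_lambda ` (\<Pi>\<^sub>E i\<in>UNIV. {..n $ i})"
      using vec_nth_inverse[of m] by (metis image_eqI)
  qed
  show "finite (vec_lambda ` (\<Pi>\<^sub>E i\<in>(UNIV :: 'k set). {..n $ i}))"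
    by (intro finite_imageI finite_PiE) auto
qed

lemma int_vec_diff_eq_iff:
  "int_vec l - int_vec m = int_vec l' - int_vec m' \<longleftrightarrow> l + m' = l' + (m :: nat ^ 'k::finite)"
proof -
  have "int a - int b = int c - int d \<longleftrightarrow> a + d = c + b" for a b c d
    by linarith
  then show ?thesis
    by (simp add: int_vec_def vec_eq_iff)
qed

lemma int_vec_add: "int_vec (l + m) = int_vec l + int_vec m"
  by (simp add: int_vec_def vec_eq_iff)

definition prefix_of :: "('a, 'm) arrow_category_scheme \<Rightarrow> 'a \<Rightarrow> 'a \<Rightarrow> bool" where
  "prefix_of C a b \<longleftrightarrow> (\<exists>c. composable C a c \<and> b = cmp C a c)"

context arrow_cat
begin

lemma composable_dm: "a \<in> arrows C \<Longrightarrow> composable C a (dm C a)"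
  using rg_ident[OF dm_idents] by (simp add: composable_def dm_arrows)

lemma composable_rg: "a \<in> arrows C \<Longrightarrow> composable C (rg C a) a"
  using dm_ident[OF rg_idents] by (simp add: composable_def rg_arrows)

lemma prefix_ofI: "composable C a c \<Longrightarrow> prefix_of C a (a \<cdot> c)"
  unfolding prefix_of_def by blast

lemma prefix_of_refl: "a \<in> arrows C \<Longrightarrow> prefix_of C a a"
  using prefix_ofI[OF composable_dm] by (simp add: cmp_dm)

lemma prefix_of_trans: "prefix_of C a b \<Longrightarrow> prefix_of C b c \<Longrightarrow> prefix_of C a c"
  unfolding prefix_of_def by (metis cmp_assoc composable_cmp composable_def dm_cmp)

lemma prefix_of_arrows: "prefix_of C a b \<Longrightarrow> a \<in> arrows C \<and> b \<in> arrows C"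
  unfolding prefix_of_def by (auto simp: composable_def intro: cmp_arrows[unfolded composable_def])

end

context k_graph
begin

lemma cancel:
  assumes "composable C a b" "composable C a' b'" "a \<cdot> b = a' \<cdot> b'" "deg C a = deg C a'"
  shows "a = a'" "b = b'"
proof -
  have "a \<cdot> b \<in> arrows C" "deg C (a \<cdot> b) = deg C a + deg C b"
    using assms(1) by (simp_all add: cmp_arrows deg_cmp)
  note unique = unique_factorization[OF this]
  have "deg C a + deg C b = deg C a + deg C b'"
    using assms deg_cmp by metis
  then have "deg C b' = deg C b"
    by simp
  define P where "P = (\<lambda>(x, y). composable C x y \<and> a \<cdot> b = x \<cdot> y \<and> deg C x = deg C a \<and> deg C y = deg C b)"
  have "P (a, b)" "P (a', b')"
    using assms \<open>deg C b' = deg C b\<close> by (simp_all add: P_def)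
  moreover have "\<exists>!p. P p"
    using unique unfolding P_def .
  ultimately have "(a, b) = (a', b')"
    by blast
  then show "a = a'" "b = b'"
    by simp_all
qed

lemma ex_prefix_of_deg:
  assumes "a \<in> arrows C" "m \<le> deg C a"
  obtains b c where "composable C b c" "a = b \<cdot> c" "deg C b = m"
proof -
  have "deg C a = m + (deg C a - m)"
    using assms by (simp add: add_diff_vec)
  from unique_factorization[OF assms(1) this] show ?thesis
    using that by auto
qed

lemma deg_zero_ident:
  assumes "a \<in> arrows C" "deg C a = 0"
  shows "a \<in> idents C"
proof -
  have "rg C a \<cdot> a = a \<cdot> dm C a" "deg C (rg C a) = deg C a"
    using assms deg_ident[OF rg_idents] by (simp_all add: rg_cmp_self cmp_dm)
  from cancel(1)[OF composable_rg[OF assms(1)] composable_dm[OF assms(1)] this]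
  show ?thesis
    using rg_idents[OF assms(1)] by simp
qed

lemma prefix_of_deg: "prefix_of C a b \<Longrightarrow> deg C a \<le> deg C b"
  unfolding prefix_of_def by (auto simp: deg_cmp le_add_vec)

text \<open>Unique factorization makes the initial segments of one arrow comparable whenever their degrees
  are, and in particular determined by their degrees.\<close>

lemma prefix_of_linear:
  assumes "prefix_of C a c" "prefix_of C b c" "deg C a \<le> deg C b"
  shows "prefix_of C a b"
proof -
  obtain x y where x: "composable C a x" "c = a \<cdot> x" and y: "composable C b y" "c = b \<cdot> y"
    using assms unfolding prefix_of_def by blast
  have "b \<in> arrows C"
    using y by (simp add: composable_def)
  then obtain b1 b2 where b: "composable C b1 b2" "b = b1 \<cdot> b2" "deg C b1 = deg C a"
    using assms(3) by (rule ex_prefix_of_deg)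
  have b2: "composable C b2 y"
    using b y dm_cmp[OF b(1)] by (simp add: composable_def)
  have "a \<cdot> x = b1 \<cdot> (b2 \<cdot> y)"
    using x y b b2 by (simp add: cmp_assoc)
  from cancel(1)[OF x(1) composable_cmp(2)[OF b(1) b2] this] b(3) have "a = b1"
    by simp
  with b show ?thesis
    by (simp add: prefix_ofI)
qed

lemma prefix_of_deg_eq:
  assumes "prefix_of C a c" "prefix_of C b c" "deg C a = deg C b"
  shows "a = b"
  using assms cancel(1) unfolding prefix_of_def by metis

lemma ex_prefix_of:
  assumes "a \<in> arrows C" "m \<le> deg C a"
  shows "\<exists>b. prefix_of C b a \<and> deg C b = m"
  using ex_prefix_of_deg[OF assms] prefix_ofI by metis


section \<open>Tilings\<close>

lemma tiling_arrows: "w \<in> tilings C \<Longrightarrow> m \<le> n \<Longrightarrow> w m n \<in> arrows C"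
  and tiling_deg: "w \<in> tilings C \<Longrightarrow> m \<le> n \<Longrightarrow> deg C (w m n) = n - m"
  and tiling_ident: "w \<in> tilings C \<Longrightarrow> w m m \<in> idents C"
  and tiling_composable: "w \<in> tilings C \<Longrightarrow> m \<le> n \<Longrightarrow> n \<le> p \<Longrightarrow> composable C (w m n) (w n p)"
  and tiling_cmp: "w \<in> tilings C \<Longrightarrow> m \<le> n \<Longrightarrow> n \<le> p \<Longrightarrow> w m n \<cdot> w n p = w m p"
  by (auto simp: tilings_def)

lemma tiling_dm:
  assumes "w \<in> tilings C" "m \<le> n"
  shows "dm C (w m n) = w n n"
  using tiling_composable[OF assms order_refl] rg_ident[OF tiling_ident[OF assms(1), of n]]
  by (simp add: composable_def)

lemma tiling_arrows0: "w \<in> tilings C \<Longrightarrow> w 0 n \<in> arrows C"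
  and tiling_deg0: "w \<in> tilings C \<Longrightarrow> deg C (w 0 n) = n"
  and tiling_dm0: "w \<in> tilings C \<Longrightarrow> dm C (w 0 n) = w n n"
  by (simp_all add: tiling_arrows tiling_deg tiling_dm less_eq_vec_def vec_eq_iff)

lemma tiling_rg0:
  assumes "w \<in> tilings C"
  shows "rg C (w 0 n) = w 0 0"
  using tiling_composable[OF assms, of 0 0 n] dm_ident[OF tiling_ident[OF assms, of 0]]
  by (simp add: composable_def less_eq_vec_def)

lemma tiling_split:
  assumes "w \<in> tilings C"
  shows "composable C (w 0 m) (w m (m + n))" "w 0 (m + n) = w 0 m \<cdot> w m (m + n)"
  using assms tiling_composable[of w 0 m "m + n"] tiling_cmp[of w 0 m "m + n"]
  by (simp_all add: less_eq_vec_def)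

lemma tiling_prefix: "w \<in> tilings C \<Longrightarrow> m \<le> n \<Longrightarrow> prefix_of C (w 0 m) (w 0 n)"
  using prefix_ofI[OF tiling_split(1)] tiling_split(2) add_diff_vec by metis

lemma tiling_prefix_eq:
  assumes "w \<in> tilings C" "prefix_of C a (w 0 n)" "deg C a = m"
  shows "w 0 m = a"
proof (rule prefix_of_deg_eq[OF _ assms(2)])
  have "m \<le> n"
    using prefix_of_deg[OF assms(2)] assms by (simp add: tiling_deg0)
  then show "prefix_of C (w 0 m) (w 0 n)"
    using assms(1) by (rule tiling_prefix[rotated])
qed (use assms in \<open>simp add: tiling_deg0\<close>)

text \<open>The initial segments of degree at least \<open>m\<close> are cofinal, so they determine all initial
  segments by unique factorization, and then all other segments by cancellation.\<close>

lemma tiling_eqI: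
  assumes w: "w \<in> tilings C" and v: "v \<in> tilings C" and eq: "\<And>n. w 0 (m + n) = v 0 (m + n)"
  shows "w = v"
proof (intro ext)
  fix p q
  have eq0: "w 0 n = v 0 n" for n
  proof (rule prefix_of_deg_eq)
    show "prefix_of C (w 0 n) (w 0 (m + n))"
      using w by (intro tiling_prefix) (simp_all add: less_eq_vec_def)
    show "prefix_of C (v 0 n) (w 0 (m + n))"
      unfolding eq using v by (intro tiling_prefix) (simp_all add: less_eq_vec_def)
  qed (use w v in \<open>simp add: tiling_deg0\<close>)
  show "w p q = v p q"
  proof (cases "p \<le> q")
    case True
    then obtain n where q: "q = p + n"
      using add_diff_vec by metis
    have "w 0 p \<cdot> w p q = v 0 p \<cdot> v p q"
      using tiling_split(2)[OF w, of p n] tiling_split(2)[OF v, of p n] eq0[of q] q by simp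
    then show ?thesis
      using cancel(2)[of "w 0 p" "w p q" "v 0 p" "v p q"] tiling_split(1)[OF w, of p n]
        tiling_split(1)[OF v, of p n] eq0[of p] q by simp
  next
    case False
    then show ?thesis
      using w v by (simp add: tilings_def)
  qed
qed

lemma shift_tiling:
  assumes "w \<in> tilings C"
  shows "shift p w \<in> tilings C"
proof -
  have "p + n - (p + m) = n - m" "p + m \<le> p + n \<longleftrightarrow> m \<le> n" for m n :: "nat ^ 'k"
    by (simp_all add: vec_eq_iff less_eq_vec_def)
  then show ?thesis
    using assms by (simp add: tilings_def shift_def)
qed

lemma shift_apply: "shift p w m n = w (p + m) (p + n)"
  by (simp add: shift_def)

lemma shift_shift: "shift p (shift q w) = shift (q + p) w"
  by (simp add: shift_def add.assoc)

lemma shift_eq_apply: "shift l w = shift m v \<Longrightarrow> w (l + p) (l + q) = v (m + p) (m + q)"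
  by (metis shift_apply)

lemma shift_eq_apply0: "shift l w = shift m v \<Longrightarrow> w l (l + q) = v m (m + q)"
  using shift_eq_apply[of l w m v 0 q] by simp

lemma shift_eq_ends: "shift l w = shift m v \<Longrightarrow> w l l = v m m"
  using shift_eq_apply[of l w m v 0 0] by simp

lemma shift_eq_add: "shift l w = shift m v \<Longrightarrow> shift (l + p) w = shift (m + p) v"
  by (metis shift_shift)

lemma tiling_eqI_shift:
  assumes "w \<in> tilings C" "v \<in> tilings C" "w 0 m = v 0 m" "shift m w = shift m v"
  shows "w = v"
  using assms(1,2)
proof (rule tiling_eqI)
  fix n
  have "w m (m + n) = v m (m + n)"
    using shift_eq_apply0[OF assms(4)] .
  then show "w 0 (m + n) = v 0 (m + n)"
    using assms by (simp add: tiling_split(2))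
qed

text \<open>Conversely, a coherent choice of one arrow of each degree extends to a tiling: by unique
  factorization the segment from \<open>m\<close> to \<open>n\<close> is what has to be appended to the arrow of
  degree \<open>m\<close> to obtain the arrow of degree \<open>n\<close>.\<close>

lemma tiling_of_prefixes:
  assumes deg: "\<And>n. deg C (z n) = n" and pre: "\<And>m n. m \<le> n \<Longrightarrow> prefix_of C (z m) (z n)"
  shows "\<exists>w\<in>tilings C. \<forall>n. w 0 n = z n"
proof -
  have "\<forall>m n. \<exists>c. m \<le> n \<longrightarrow> composable C (z m) c \<and> z n = z m \<cdot> c"
    using pre unfolding prefix_of_def by blast
  then obtain c where c: "\<And>m n. m \<le> n \<Longrightarrow> composable C (z m) (c m n)"
      "\<And>m n. m \<le> n \<Longrightarrow> z n = z m \<cdot> c m n"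
    by metis
  have z: "z n \<in> arrows C" for n
    using pre[of n n] prefix_of_arrows by auto
  have c_refl: "c m m = dm C (z m)" for m
    using cancel(2)[OF c(1)[of m m] composable_dm[OF z[of m]]] c(2)[of m m] z[of m]
    by (simp add: cmp_dm)
  have c_comp: "composable C (c m n) (c n p)" if "m \<le> n" "n \<le> p" for m n p
  proof -
    have "dm C (c m n) = dm C (z n)"
      using c[OF that(1)] dm_cmp by metis
    then show ?thesis
      using c(1)[OF that(1)] c(1)[OF that(2)] by (simp add: composable_def)
  qed
  have c_cmp: "c m n \<cdot> c n p = c m p" if "m \<le> n" "n \<le> p" for m n p
  proof -
    have mp: "m \<le> p"
      using that by (rule order_trans)
    have "z m \<cdot> (c m n \<cdot> c n p) = (z m \<cdot> c m n) \<cdot> c n p"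
      using c(1)[OF that(1)] c_comp[OF that] by (simp add: cmp_assoc)
    also have "\<dots> = z m \<cdot> c m p"
      using c(2)[OF that(1)] c(2)[OF that(2)] c(2)[OF mp] by simp
    finally show ?thesis
      using cancel(2)[OF composable_cmp(2)[OF c(1)[OF that(1)] c_comp[OF that]] c(1)[OF mp]]
      by simp
  qed
  have c_deg: "deg C (c m n) = n - m" if "m \<le> n" for m n
  proof -
    have "n = m + deg C (c m n)"
      using deg_cmp[OF c(1)[OF that]] c(2)[OF that] deg by metis
    then show ?thesis
      by (metis diff_add_vec)
  qed
  define w where "w = (\<lambda>m n. if m \<le> n then c m n else undefined)"
  have "w \<in> tilings C"
    unfolding tilings_def w_def
    using c(1) c_deg c_comp c_cmp dm_idents[OF z] c_refl
    by (auto simp: composable_def dest: order_trans)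
  moreover have "w 0 n = z n" for n
  proof -
    have le: "0 \<le> n"
      by (simp add: less_eq_vec_def)
    have "dm C (z 0) = z 0"
      using deg_zero_ident[OF z deg] dm_ident by blast
    then have "rg C (c 0 n) = z 0"
      using c(1)[OF le] by (simp add: composable_def)
    then have "z 0 \<cdot> c 0 n = c 0 n"
      using c(1)[OF le] rg_cmp_self[of "c 0 n"] by (simp add: composable_def)
    then show ?thesis
      using c(2)[OF le] le by (simp add: w_def)
  qed
  ultimately show ?thesis
    by blast
qed

text \<open>The initial segment of degree \<open>n\<close> of the tiling \<open>x w\<close> is cut out of \<open>x \<cdot> w 0 n\<close>, which is
  long enough.\<close>

lemma ex_prepend:
  assumes x: "x \<in> arrows C" and w: "w \<in> tilings C" and e: "w 0 0 = dm C x"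
  shows "\<exists>v\<in>tilings C. v 0 (deg C x) = x \<and> shift (deg C x) v = w"
proof -
  have comp: "composable C x (w 0 n)" for n
    using x w e by (simp add: composable_def tiling_arrows0 tiling_rg0)
  have mono: "prefix_of C (x \<cdot> w 0 m) (x \<cdot> w 0 n)" if le: "m \<le> n" for m n
  proof -
    obtain p where n: "n = m + p"
      using add_diff_vec[OF le] by metis
    have "x \<cdot> w 0 n = (x \<cdot> w 0 m) \<cdot> w m n"
      unfolding n tiling_split(2)[OF w] using comp tiling_split(1)[OF w] by (simp add: cmp_assoc)
    then show ?thesis
      using prefix_ofI[OF composable_cmp(1)[OF comp tiling_split(1)[OF w]]] n by metis
  qed
  have deg: "deg C (x \<cdot> w 0 n) = deg C x + n" for n
    using comp w by (simp add: deg_cmp tiling_deg0)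
  have "\<exists>b. prefix_of C b (x \<cdot> w 0 n) \<and> deg C b = n" for n
    by (rule ex_prefix_of) (simp_all add: comp cmp_arrows deg less_eq_vec_def)
  then obtain z where z: "\<And>n. prefix_of C (z n) (x \<cdot> w 0 n)" "\<And>n. deg C (z n) = n"
    by metis
  have "prefix_of C (z m) (z n)" if "m \<le> n" for m n
    using prefix_of_linear[OF prefix_of_trans[OF z(1) mono[OF that]] z(1)] that z(2) by simp
  then obtain v where v: "v \<in> tilings C" "\<And>n. v 0 n = z n"
    using tiling_of_prefixes[of z] z(2) by blast
  have vx: "v 0 (deg C x) = x"
    unfolding v(2) using prefix_of_deg_eq[OF z(1)[of "deg C x"] prefix_ofI[OF comp]] z(2) by blast
  have vxw: "v 0 (deg C x + n) = x \<cdot> w 0 n" for n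
    unfolding v(2)
  proof (rule prefix_of_deg_eq[OF z(1)])
    show "prefix_of C (x \<cdot> w 0 n) (x \<cdot> w 0 (deg C x + n))"
      by (rule mono) (simp add: less_eq_vec_def)
  qed (simp add: z(2) deg)
  have "shift (deg C x) v = w"
  proof (rule tiling_eqI[OF shift_tiling[OF v(1)] w, of _ 0])
    fix n
    have "x \<cdot> v (deg C x) (deg C x + n) = x \<cdot> w 0 n"
      using tiling_split(2)[OF v(1), of "deg C x" n] vx vxw by simp
    moreover have "composable C x (v (deg C x) (deg C x + n))"
      using tiling_split(1)[OF v(1), of "deg C x" n] vx by simp
    ultimately show "shift (deg C x) v 0 (0 + n) = w 0 (0 + n)"
      using cancel(2)[OF _ comp] by (simp add: shift_apply)
  qed
  with v(1) vx show ?thesis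
    by blast
qed

lemma prepend_eq:
  assumes "v \<in> tilings C" "v 0 (deg C x) = x"
  shows "prepend C x (shift (deg C x) v) = v"
  unfolding prepend_def
  by (rule the_equality) (use assms in \<open>auto intro: tiling_eqI_shift[of _ v "deg C x"]\<close>)

lemma prepend:
  assumes "x \<in> arrows C" "w \<in> tilings C" "w 0 0 = dm C x"
  shows "prepend C x w \<in> tilings C" "prepend C x w 0 (deg C x) = x"
    "shift (deg C x) (prepend C x w) = w"
  using ex_prepend[OF assms] prepend_eq by auto

text \<open>Coherent arrows of the degrees \<open>(j, \<dots>, j)\<close> suffice, as these degrees are cofinal.\<close>

lemma tiling_of_sequence:
  assumes deg: "\<And>j :: nat. deg C (a j) = (\<chi> i. j)"
    and pre: "\<And>j. prefix_of C (a j) (a (Suc j))"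
  shows "\<exists>w\<in>tilings C. \<forall>j. w 0 (\<chi> i. j) = a j"
proof -
  have mono: "prefix_of C (a j) (a k)" if "j \<le> k" for j k
    using that
  proof (induction k rule: dec_induct)
    case base
    then show ?case
      using prefix_of_arrows[OF pre[of j]] by (auto intro: prefix_of_refl)
  next
    case (step k)
    then show ?case
      using prefix_of_trans pre by blast
  qed
  define N where "N n = (\<Sum>i\<in>UNIV. n $ i)" for n :: "nat ^ 'k"
  have N: "n \<le> (\<chi> i. N n)" for n
    by (simp add: less_eq_vec_def N_def member_le_sum)
  have N_mono: "N m \<le> N n" if "m \<le> n" for m n
    using that unfolding N_def by (intro sum_mono) (simp add: less_eq_vec_def)
  have "\<exists>b. prefix_of C b (a (N n)) \<and> deg C b = n" for n
    by (rule ex_prefix_of) (use prefix_of_arrows[OF pre] N deg in auto)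
  then obtain z where z: "\<And>n. prefix_of C (z n) (a (N n))" "\<And>n. deg C (z n) = n"
    by metis
  have "prefix_of C (z m) (z n)" if "m \<le> n" for m n
    using prefix_of_linear[OF prefix_of_trans[OF z(1) mono[OF N_mono[OF that]]] z(1)] that z(2)
    by simp
  then obtain w where w: "w \<in> tilings C" "\<And>n. w 0 n = z n"
    using tiling_of_prefixes[of z] z(2) by blast
  have "z (\<chi> i. j) = a j" for j
  proof (rule prefix_of_deg_eq[OF prefix_of_trans[OF z(1) mono] mono])
    show "N (\<chi> i. j) \<le> max (N (\<chi> i. j)) j" "j \<le> max (N (\<chi> i. j)) j"
      by auto
  qed (simp add: z(2) deg)
  then show ?thesis
    using w by (intro bexI[of _ w]) simp_all
qed

lemma tiling_growth:
  assumes e: "e \<in> idents C" "P e"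
    and grow: "\<And>z. z \<in> arrows C \<Longrightarrow> P z \<Longrightarrow> \<exists>c. composable C z c \<and> deg C c = 1 \<and> P (z \<cdot> c)"
  shows "\<exists>w\<in>tilings C. w 0 0 = e \<and> (\<forall>j :: nat. P (w 0 (\<chi> i. j)))"
proof -
  have "\<exists>a. \<forall>j. (a j \<in> arrows C \<and> deg C (a j) = (\<chi> i. j) \<and> P (a j) \<and> (j = 0 \<longrightarrow> a j = e)) \<and>
      prefix_of C (a j) (a (Suc j))"
  proof (rule dependent_nat_choice)
    show "\<exists>x. x \<in> arrows C \<and> deg C x = (\<chi> i. 0) \<and> P x \<and> (0 = 0 \<longrightarrow> x = e)"
      using e by (auto simp: idents_arrows deg_ident vec_eq_iff)
  next
    fix x j assume x: "x \<in> arrows C \<and> deg C x = (\<chi> i. j) \<and> P x \<and> (j = 0 \<longrightarrow> x = e)"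
    then obtain c where c: "composable C x c" "deg C c = 1" "P (x \<cdot> c)"
      using grow by blast
    then have "deg C (x \<cdot> c) = (\<chi> i. Suc j)"
      using x by (simp add: deg_cmp vec_eq_iff)
    then show "\<exists>y. (y \<in> arrows C \<and> deg C y = (\<chi> i. Suc j) \<and> P y \<and> (Suc j = 0 \<longrightarrow> y = e)) \<and>
        prefix_of C x y"
      using c by (intro exI[of _ "x \<cdot> c"]) (auto simp: cmp_arrows prefix_ofI)
  qed
  then obtain a where a: "\<And>j. deg C (a j) = (\<chi> i. j)" "\<And>j. P (a j)" "a 0 = e"
    "\<And>j. prefix_of C (a j) (a (Suc j))"
    by auto
  obtain w where w: "w \<in> tilings C" "\<And>j. w 0 (\<chi> i. j) = a j"
    using tiling_of_sequence[OF a(1,4)] by blast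
  have "(0 :: nat ^ 'k) = (\<chi> i. 0)"
    by (simp add: vec_eq_iff)
  then have "w 0 0 = e"
    using w(2)[of 0] a(3) by metis
  with w a(2) show ?thesis
    by auto
qed

end


section \<open>Morphisms between finitely generated right ideals\<close>

text \<open>The elements of the monoid described without reference to the ideals: the codomain of such a
  morphism is automatically a finitely generated right ideal, generated by the images of the
  generators of the domain.\<close>

definition fg_morphism :: "('a, 'm) arrow_category_scheme \<Rightarrow> ('a \<rightharpoonup> 'a) \<Rightarrow> bool" where
  "fg_morphism C \<theta> \<longleftrightarrow>
    (\<forall>r s. \<theta> r = Some s \<longrightarrow> r \<in> arrows C \<and> s \<in> arrows C \<and> dm C s = dm C r \<and>
        (\<forall>c. composable C r c \<longrightarrow> \<theta> (cmp C r c) = Some (cmp C s c))) \<and>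
    (\<forall>r r' s. \<theta> r = Some s \<and> \<theta> r' = Some s \<longrightarrow> r = r') \<and>
    (\<exists>X. finite X \<and> X \<subseteq> dom \<theta> \<and> (\<forall>r\<in>dom \<theta>. \<exists>x\<in>X. prefix_of C x r))"

lemma fg_morphismI:
  assumes "finite X" "X \<subseteq> dom \<theta>" "\<And>r. r \<in> dom \<theta> \<Longrightarrow> \<exists>x\<in>X. prefix_of C x r"
    and "\<And>r s. \<theta> r = Some s \<Longrightarrow> r \<in> arrows C \<and> s \<in> arrows C \<and> dm C s = dm C r \<and>
      (\<forall>c. composable C r c \<longrightarrow> \<theta> (cmp C r c) = Some (cmp C s c))"
    and "\<And>r r' s. \<theta> r = Some s \<Longrightarrow> \<theta> r' = Some s \<Longrightarrow> r = r'"
  shows "fg_morphism C \<theta>"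
  unfolding fg_morphism_def
proof (intro conjI)
  show "\<exists>X. finite X \<and> X \<subseteq> dom \<theta> \<and> (\<forall>r\<in>dom \<theta>. \<exists>x\<in>X. prefix_of C x r)"
    using assms(1-3) by (intro exI[of _ X]) simp
qed (use assms(4,5) in metis)+

lemma partial_inverse_Some:
  assumes "\<And>r r' s. \<theta> r = Some s \<Longrightarrow> \<theta> r' = Some s \<Longrightarrow> r = r'"
  shows "partial_inverse \<theta> s = Some r \<longleftrightarrow> \<theta> r = Some s"
proof -
  have "(THE x. \<theta> x = Some s) = r" if "\<theta> r = Some s" for r
    using that assms by (intro the_equality) blast+
  then show ?thesis
    by (auto simp: partial_inverse_def ran_def)
qed

context arrow_cat
begin

lemma fg_morphism_arrows:
  assumes "fg_morphism C \<theta>" "\<theta> r = Some s"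
  shows "r \<in> arrows C" "s \<in> arrows C" "dm C s = dm C r"
  using assms unfolding fg_morphism_def by blast+

lemma fg_morphism_cmp:
  "fg_morphism C \<theta> \<Longrightarrow> \<theta> r = Some s \<Longrightarrow> composable C r c \<Longrightarrow> \<theta> (r \<cdot> c) = Some (s \<cdot> c)"
  unfolding fg_morphism_def by blast

lemma fg_morphism_composable:
  "fg_morphism C \<theta> \<Longrightarrow> \<theta> r = Some s \<Longrightarrow> composable C s c \<longleftrightarrow> composable C r c"
  using fg_morphism_arrows by (simp add: composable_def)

lemma fg_morphism_inj:
  "fg_morphism C \<theta> \<Longrightarrow> \<theta> r = Some s \<Longrightarrow> \<theta> r' = Some s \<Longrightarrow> r = r'"
  unfolding fg_morphism_def by blast

lemma fg_morphism_generators: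
  assumes "fg_morphism C \<theta>"
  obtains X where "finite X" "X \<subseteq> dom \<theta>" "\<And>r. r \<in> dom \<theta> \<Longrightarrow> \<exists>x\<in>X. prefix_of C x r"
  using assms unfolding fg_morphism_def by blast

lemma fg_morphism_dom_closed:
  assumes "fg_morphism C \<theta>" "r \<in> dom \<theta>" "prefix_of C r r'"
  shows "r' \<in> dom \<theta>"
  using assms fg_morphism_cmp unfolding prefix_of_def by blast

lemma R_monoid_carrier: "carrier (R_monoid C) = {\<theta>. fg_morphism C \<theta>}"
proof (intro equalityI subsetI)
  fix \<theta> assume "\<theta> \<in> carrier (R_monoid C)"
  then obtain R1 R2 where R: "fg_right_ideal C R1" "fg_right_ideal C R2"
    and \<theta>: "bijective_morphism C R1 R2 \<theta>"
    by (auto simp: R_monoid_def)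
  obtain X where X: "finite X" "X \<subseteq> arrows C" "R1 = set_cmp C X (arrows C)"
    using R(1) unfolding fg_right_ideal_def by blast
  have sub: "R1 \<subseteq> arrows C" "R2 \<subseteq> arrows C"
    using R unfolding fg_right_ideal_def right_ideal_def by auto
  have dom: "dom \<theta> = R1" "ran \<theta> = R2" "inj_on \<theta> R1"
    and eq: "\<And>r. r \<in> R1 \<Longrightarrow> dm C (the (\<theta> r)) = dm C r"
      "\<And>r c. r \<in> R1 \<Longrightarrow> composable C r c \<Longrightarrow> \<theta> (r \<cdot> c) = Some (the (\<theta> r) \<cdot> c)"
    using \<theta> unfolding bijective_morphism_def by auto
  have "X \<subseteq> dom \<theta>"
  proof
    fix x assume "x \<in> X"
    then have "x \<cdot> dm C x \<in> R1"
      using X(2) composable_dm dm_arrows unfolding X(3) set_cmp_def by blast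
    then show "x \<in> dom \<theta>"
      using \<open>x \<in> X\<close> X(2) cmp_dm[of x] dom by auto
  qed
  moreover have "\<exists>x\<in>X. prefix_of C x r" if "r \<in> dom \<theta>" for r
    using that unfolding dom X(3) set_cmp_def prefix_of_def by blast
  moreover have "r \<in> arrows C \<and> s \<in> arrows C \<and> dm C s = dm C r \<and>
      (\<forall>c. composable C r c \<longrightarrow> \<theta> (r \<cdot> c) = Some (s \<cdot> c))" if "\<theta> r = Some s" for r s
  proof -
    have "r \<in> R1" "s \<in> R2"
      using that dom(1) ranI[of \<theta> r s] dom(2) by auto
    then show ?thesis
      using sub eq[of r] that by auto
  qed
  moreover have "r = r'" if "\<theta> r = Some s" "\<theta> r' = Some s" for r r' s
    using that dom(1,3) by (auto simp: inj_on_def dom_def)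
  ultimately have "fg_morphism C \<theta>"
    using X(1) by (rule fg_morphismI[rotated])
  then show "\<theta> \<in> {\<theta>. fg_morphism C \<theta>}"
    by simp
next
  fix \<theta> assume "\<theta> \<in> {\<theta>. fg_morphism C \<theta>}"
  then have \<theta>: "fg_morphism C \<theta>" by simp
  obtain X where X: "finite X" "X \<subseteq> dom \<theta>" "\<And>r. r \<in> dom \<theta> \<Longrightarrow> \<exists>x\<in>X. prefix_of C x r"
    using fg_morphism_generators[OF \<theta>] by blast
  have dom: "dom \<theta> \<subseteq> arrows C" "ran \<theta> \<subseteq> arrows C"
    using fg_morphism_arrows[OF \<theta>] by (auto simp: ran_def)
  have "right_ideal C (dom \<theta>)"
    using dom fg_morphism_dom_closed[OF \<theta>] prefix_ofI
    unfolding right_ideal_def set_cmp_def by blast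
  moreover have "dom \<theta> = set_cmp C X (arrows C)"
  proof (intro equalityI subsetI)
    fix r assume "r \<in> dom \<theta>"
    then show "r \<in> set_cmp C X (arrows C)"
      using X(3) unfolding set_cmp_def prefix_of_def composable_def by blast
  next
    fix r assume "r \<in> set_cmp C X (arrows C)"
    then show "r \<in> dom \<theta>"
      using X(2) fg_morphism_dom_closed[OF \<theta>] prefix_ofI unfolding set_cmp_def by blast
  qed
  ultimately have 1: "fg_right_ideal C (dom \<theta>)"
    using X(1) subset_trans[OF X(2) dom(1)] unfolding fg_right_ideal_def by metis
  have ran_cmp: "s \<cdot> c \<in> ran \<theta>" if s: "s \<in> ran \<theta>" "composable C s c" for s c
  proof -
    obtain r where "\<theta> r = Some s"
      using s(1) by (auto simp: ran_def)
    then have "\<theta> (r \<cdot> c) = Some (s \<cdot> c)"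
      using s(2) fg_morphism_cmp[OF \<theta>] fg_morphism_composable[OF \<theta>] by blast
    then show ?thesis
      by (rule ranI)
  qed
  then have "right_ideal C (ran \<theta>)"
    using dom(2) unfolding right_ideal_def set_cmp_def by blast
  moreover have im: "(\<lambda>x. the (\<theta> x)) ` X \<subseteq> ran \<theta>"
    using X(2) by (fastforce intro: ranI)
  moreover have "ran \<theta> = set_cmp C ((\<lambda>x. the (\<theta> x)) ` X) (arrows C)"
  proof (intro equalityI subsetI)
    fix s assume "s \<in> ran \<theta>"
    then obtain r where r: "\<theta> r = Some s"
      by (auto simp: ran_def)
    then obtain x c where x: "x \<in> X" "composable C x c" "r = x \<cdot> c"
      using X(3) unfolding prefix_of_def by blast
    then obtain y where y: "\<theta> x = Some y"
      using X(2) by blast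
    then have "s = y \<cdot> c" "composable C y c"
      using fg_morphism_cmp[OF \<theta> y x(2)] fg_morphism_composable[OF \<theta> y] r x by auto
    moreover have "y \<in> (\<lambda>x. the (\<theta> x)) ` X"
      using x(1) y by (metis imageI option.sel)
    ultimately show "s \<in> set_cmp C ((\<lambda>x. the (\<theta> x)) ` X) (arrows C)"
      unfolding set_cmp_def composable_def by blast
  next
    fix s assume "s \<in> set_cmp C ((\<lambda>x. the (\<theta> x)) ` X) (arrows C)"
    then show "s \<in> ran \<theta>"
      using im ran_cmp unfolding set_cmp_def by blast
  qed
  ultimately have 2: "fg_right_ideal C (ran \<theta>)"
    using finite_imageI[OF X(1)] subset_trans[OF im dom(2)] unfolding fg_right_ideal_def by metis
  have "bijective_morphism C (dom \<theta>) (ran \<theta>) \<theta>"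
    using fg_morphism_arrows(3)[OF \<theta>] fg_morphism_cmp[OF \<theta>] fg_morphism_inj[OF \<theta>]
    unfolding bijective_morphism_def by (force simp: inj_on_def)
  with 1 2 show "\<theta> \<in> carrier (R_monoid C)"
    by (auto simp: R_monoid_def)
qed

lemma minv_R_monoid: "fg_morphism C \<theta> \<Longrightarrow> minv (R_monoid C) \<theta> s = Some r \<longleftrightarrow> \<theta> r = Some s"
  using partial_inverse_Some[of \<theta> s r] fg_morphism_inj by (simp add: R_monoid_def)

lemma fg_morphism_minv:
  assumes \<theta>: "fg_morphism C \<theta>"
  shows "fg_morphism C (minv (R_monoid C) \<theta>)"
proof -
  let ?\<phi> = "minv (R_monoid C) \<theta>"
  note inv = minv_R_monoid[OF \<theta>]
  obtain X where X: "finite X" "X \<subseteq> dom \<theta>" "\<And>r. r \<in> dom \<theta> \<Longrightarrow> \<exists>x\<in>X. prefix_of C x r"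
    using fg_morphism_generators[OF \<theta>] by blast
  let ?Y = "(\<lambda>x. the (\<theta> x)) ` X"
  have "?Y \<subseteq> dom ?\<phi>"
    using X(2) inv by fastforce
  moreover have "\<exists>y\<in>?Y. prefix_of C y s" if "s \<in> dom ?\<phi>" for s
  proof -
    obtain r where r: "\<theta> r = Some s"
      using \<open>s \<in> dom ?\<phi>\<close> inv by blast
    then obtain x c where x: "x \<in> X" "composable C x c" "r = x \<cdot> c"
      using X(3) unfolding prefix_of_def by blast
    then obtain y where y: "\<theta> x = Some y"
      using X(2) by blast
    then have "prefix_of C y s"
      using fg_morphism_cmp[OF \<theta> y x(2)] fg_morphism_composable[OF \<theta> y] r x prefix_ofI by auto
    then show ?thesis
      using x(1) y by force
  qed
  moreover have "s \<in> arrows C \<and> r \<in> arrows C \<and> dm C r = dm C s \<and>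
      (\<forall>c. composable C s c \<longrightarrow> ?\<phi> (s \<cdot> c) = Some (r \<cdot> c))" if "?\<phi> s = Some r" for r s
  proof -
    have r: "\<theta> r = Some s"
      using that inv by simp
    then show ?thesis
      using fg_morphism_arrows[OF \<theta> r] fg_morphism_cmp[OF \<theta> r] fg_morphism_composable[OF \<theta> r]
      by (simp add: inv)
  qed
  moreover have "s = s'" if "?\<phi> s = Some r" "?\<phi> s' = Some r" for r s s'
    using that unfolding inv by simp
  ultimately show ?thesis
    using finite_imageI[OF X(1)] by (rule fg_morphismI[rotated])
qed

lemma nat_le_R_monoidI:
  assumes "fg_morphism C \<theta>" "\<theta> \<subseteq>\<^sub>m \<phi>"
  shows "nat_le (R_monoid C) \<theta> \<phi>"
proof -
  have "\<theta> r = (\<phi> \<circ>\<^sub>m minv (R_monoid C) \<theta> \<circ>\<^sub>m \<theta>) r" for r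
  proof (cases "\<theta> r")
    case (Some s)
    then have "minv (R_monoid C) \<theta> s = Some r" "\<phi> r = Some s"
      using minv_R_monoid[OF assms(1)] assms(2) by (auto simp: map_le_def dom_def)
    with Some show ?thesis
      by simp
  qed simp
  then show ?thesis
    unfolding nat_le_def by (auto simp: R_monoid_def)
qed

lemma fg_morphism_empty: "fg_morphism C Map.empty"
  unfolding fg_morphism_def by simp

end

text \<open>The bijective morphism \<open>y \<cdot> c \<mapsto> x \<cdot> c\<close>; its germs form the basic open set determined by
  \<open>x\<close> and \<open>y\<close>.\<close>

definition translation :: "('a, 'm) arrow_category_scheme \<Rightarrow> 'a \<Rightarrow> 'a \<Rightarrow> ('a \<rightharpoonup> 'a)" where
  "translation C x y = (\<lambda>a. if prefix_of C y a
     then Some (cmp C x (THE c. composable C y c \<and> a = cmp C y c)) else None)"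

context k_graph
begin

lemma translation_cmp:
  assumes "composable C y c"
  shows "translation C x y (y \<cdot> c) = Some (x \<cdot> c)"
proof -
  have "(THE c'. composable C y c' \<and> y \<cdot> c = y \<cdot> c') = c"
  proof (rule the_equality)
    show "c' = c" if "composable C y c' \<and> y \<cdot> c = y \<cdot> c'" for c'
      using cancel(2)[OF assms, of y c'] that by simp
  qed (use assms in simp)
  then show ?thesis
    using prefix_ofI[OF assms] by (simp add: translation_def)
qed

lemma translation_Some:
  "translation C x y a = Some b \<longleftrightarrow> (\<exists>c. composable C y c \<and> a = y \<cdot> c \<and> b = x \<cdot> c)"
proof
  assume ab: "translation C x y a = Some b"
  then have "prefix_of C y a"
    by (auto simp: translation_def split: if_splits)
  then obtain c where "composable C y c" "a = y \<cdot> c"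
    unfolding prefix_of_def by blast
  with ab show "\<exists>c. composable C y c \<and> a = y \<cdot> c \<and> b = x \<cdot> c"
    by (auto simp: translation_cmp)
qed (auto simp: translation_cmp)

lemma translation_self:
  assumes "x \<in> arrows C" "y \<in> arrows C" "dm C x = dm C y"
  shows "translation C x y y = Some x"
  using translation_cmp[OF composable_dm[OF assms(2)], of x] assms cmp_dm by metis

lemma fg_morphism_translation:
  assumes "x \<in> arrows C" "y \<in> arrows C" "dm C x = dm C y"
  shows "fg_morphism C (translation C x y)"
proof -
  have xy: "composable C x c \<longleftrightarrow> composable C y c" for c
    using assms by (simp add: composable_def)
  have "a \<in> arrows C \<and> b \<in> arrows C \<and> dm C b = dm C a \<and>
      (\<forall>c. composable C a c \<longrightarrow> translation C x y (a \<cdot> c) = Some (b \<cdot> c))"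
    if ab: "translation C x y a = Some b" for a b
  proof -
    obtain d where d: "composable C y d" "a = y \<cdot> d" "b = x \<cdot> d" "composable C x d"
      using ab translation_Some[of x y a b] xy by metis
    have "translation C x y (a \<cdot> c) = Some (b \<cdot> c)" if "composable C a c" for c
    proof -
      have dc: "composable C d c"
        using that d dm_cmp[OF d(1)] by (simp add: composable_def)
      show ?thesis
        using translation_cmp[OF composable_cmp(2)[OF d(1) dc], of x] d dc by (simp add: cmp_assoc)
    qed
    then show ?thesis
      using d by (simp add: cmp_arrows dm_cmp)
  qed
  moreover have "a = a'" if "translation C x y a = Some b" "translation C x y a' = Some b" for a a' b
    using that cancel(2) xy unfolding translation_Some by metis
  moreover have "y \<in> dom (translation C x y)"
    using translation_self[OF assms] by blast
  moreover have "prefix_of C y r" if "r \<in> dom (translation C x y)" for r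
    using that by (auto simp: translation_def split: if_splits)
  ultimately show ?thesis
    by (intro fg_morphismI[of "{y}"]) auto
qed

lemma translation_map_le:
  assumes "fg_morphism C \<theta>" "\<theta> y = Some x"
  shows "translation C x y \<subseteq>\<^sub>m \<theta>"
  using fg_morphism_cmp[OF assms] unfolding map_le_def dom_def
  by (auto simp: translation_Some)

text \<open>The composite is defined on \<open>y \<cdot> c\<close> as soon as \<open>\<phi> y \<cdot> c\<close> lies in the domain of \<open>\<theta>\<close>.
  Cutting \<open>c\<close> down to degree at most \<open>N\<close>, a bound for the degrees of the generators of \<open>dom \<theta>\<close>,
  does not leave that domain; this gives generators whose number row-finiteness bounds.\<close>

lemma fg_morphism_comp:
  assumes \<theta>: "fg_morphism C \<theta>" and \<phi>: "fg_morphism C \<phi>" and rf: "row_finite C"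
  shows "fg_morphism C (\<theta> \<circ>\<^sub>m \<phi>)"
proof -
  have comp: "(\<theta> \<circ>\<^sub>m \<phi>) r = Some t \<longleftrightarrow> (\<exists>s. \<phi> r = Some s \<and> \<theta> s = Some t)" for r t
    by (auto simp: map_comp_Some_iff)
  obtain X where X: "finite X" "X \<subseteq> dom \<theta>" "\<And>r. r \<in> dom \<theta> \<Longrightarrow> \<exists>x\<in>X. prefix_of C x r"
    using fg_morphism_generators[OF \<theta>] by blast
  obtain Y where Y: "finite Y" "Y \<subseteq> dom \<phi>" "\<And>r. r \<in> dom \<phi> \<Longrightarrow> \<exists>y\<in>Y. prefix_of C y r"
    using fg_morphism_generators[OF \<phi>] by blast
  define N where "N = (\<Sum>x\<in>X. deg C x)"
  have N: "deg C x \<le> N" if "x \<in> X" for x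
    using X(1) that by (auto simp: N_def less_eq_vec_def intro!: member_le_sum[of x X "\<lambda>x. deg C x $ i" for i])
  define F where "F y = {c \<in> arrows C. rg C c = dm C y \<and> deg C c \<le> N}" for y
  have F: "finite (F y)" if "y \<in> Y" for y
  proof -
    have "dm C y \<in> idents C"
      using that Y(2) fg_morphism_arrows(1)[OF \<phi>] dm_idents by blast
    then have "finite (\<Union>m\<in>{m. m \<le> N}. {c \<in> arrows C. rg C c = dm C y \<and> deg C c = m})"
      using rf finite_atMost_vec unfolding row_finite_def by (intro finite_UN_I) auto
    then show ?thesis
      by (rule rev_finite_subset) (auto simp: F_def)
  qed
  define Z where "Z = (\<Union>y\<in>Y. (\<lambda>c. y \<cdot> c) ` F y) \<inter> dom (\<theta> \<circ>\<^sub>m \<phi>)"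
  have "finite Z"
    using Y(1) F by (auto simp: Z_def)
  moreover have "Z \<subseteq> dom (\<theta> \<circ>\<^sub>m \<phi>)"
    by (simp add: Z_def)
  moreover have "\<exists>z\<in>Z. prefix_of C z r" if r: "r \<in> dom (\<theta> \<circ>\<^sub>m \<phi>)" for r
  proof -
    obtain s where s: "\<phi> r = Some s" "s \<in> dom \<theta>"
      using r comp by blast
    then obtain y c where y: "y \<in> Y" "composable C y c" "r = y \<cdot> c"
      using Y(3) unfolding prefix_of_def by blast
    then obtain u where u: "\<phi> y = Some u"
      using Y(2) by blast
    have uc: "s = u \<cdot> c" "composable C u c"
      using fg_morphism_cmp[OF \<phi> u y(2)] fg_morphism_composable[OF \<phi> u] s y by auto
    obtain x where x: "x \<in> X" "prefix_of C x s"
      using X(3) s by blast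
    have c: "c \<in> arrows C"
      using y(2) by (simp add: composable_def)
    obtain c0 c1 where c0: "composable C c0 c1" "c = c0 \<cdot> c1" "deg C c0 = (\<chi> i. min (deg C c $ i) (N $ i))"
      by (rule ex_prefix_of_deg[OF c, of "\<chi> i. min (deg C c $ i) (N $ i)"]) (auto simp: less_eq_vec_def)
    have yc0: "composable C y c0" and uc0: "composable C u c0"
      using y(2) uc(2) c0 rg_cmp[OF c0(1)] by (auto simp: composable_def)
    have "deg C x $ i \<le> (deg C u + deg C c0) $ i" for i
    proof -
      have "deg C x $ i \<le> deg C s $ i" "deg C x $ i \<le> N $ i"
        using prefix_of_deg[OF x(2)] N[OF x(1)] by (auto simp: less_eq_vec_def)
      then show ?thesis
        using uc c0(3) by (simp add: deg_cmp min_def)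
    qed
    then have "deg C x \<le> deg C (u \<cdot> c0)"
      using uc0 by (simp add: less_eq_vec_def deg_cmp)
    moreover have "prefix_of C (u \<cdot> c0) s"
      using prefix_ofI[OF composable_cmp(1)[OF uc0 c0(1)]] uc(1) c0 uc0 by (simp add: cmp_assoc)
    ultimately have "prefix_of C x (u \<cdot> c0)"
      using prefix_of_linear[OF x(2)] by blast
    then have "u \<cdot> c0 \<in> dom \<theta>"
      using fg_morphism_dom_closed[OF \<theta>] X(2) x(1) by blast
    then have "y \<cdot> c0 \<in> dom (\<theta> \<circ>\<^sub>m \<phi>)"
      using fg_morphism_cmp[OF \<phi> u yc0] by auto
    moreover have "c0 \<in> F y"
      using yc0 c0(3) by (auto simp: F_def composable_def less_eq_vec_def)
    moreover have "prefix_of C (y \<cdot> c0) r"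
      using prefix_ofI[OF composable_cmp(1)[OF yc0 c0(1)]] y c0 yc0 by (simp add: cmp_assoc)
    ultimately show ?thesis
      using y(1) unfolding Z_def by blast
  qed
  moreover have "r \<in> arrows C \<and> t \<in> arrows C \<and> dm C t = dm C r \<and>
      (\<forall>c. composable C r c \<longrightarrow> (\<theta> \<circ>\<^sub>m \<phi>) (r \<cdot> c) = Some (t \<cdot> c))" if rt: "(\<theta> \<circ>\<^sub>m \<phi>) r = Some t" for r t
  proof -
    obtain s where s: "\<phi> r = Some s" "\<theta> s = Some t"
      using rt comp by blast
    show ?thesis
      using fg_morphism_arrows[OF \<phi> s(1)] fg_morphism_arrows[OF \<theta> s(2)]
        fg_morphism_cmp[OF \<phi> s(1)] fg_morphism_cmp[OF \<theta> s(2)] fg_morphism_composable[OF \<phi> s(1)]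
      by simp
  qed
  moreover have "r = r'" if "(\<theta> \<circ>\<^sub>m \<phi>) r = Some t" "(\<theta> \<circ>\<^sub>m \<phi>) r' = Some t" for r r' t
    using that fg_morphism_inj[OF \<theta>] fg_morphism_inj[OF \<phi>] unfolding comp by metis
  ultimately show ?thesis
    by (rule fg_morphismI)
qed

end


section \<open>The bisections of the groupoid of tilings\<close>

lemma tiling_groupoid_sel:
  "arrows (tiling_groupoid C) = {(w1, n, w2). w1 \<in> tilings C \<and> w2 \<in> tilings C \<and>
     (\<exists>l m. n = int_vec l - int_vec m \<and> shift l w1 = shift m w2)}"
  "dm (tiling_groupoid C) (w1, n, w2) = (w2, 0, w2)"
  "rg (tiling_groupoid C) (w1, n, w2) = (w1, 0, w1)"
  "cmp (tiling_groupoid C) (w1, n, w2) (w2', n', w3) = (w1, n + n', w3)"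
  "ginv (tiling_groupoid C) (w1, n, w2) = (w2, - n, w1)"
  by (simp_all add: tiling_groupoid_def)

lemma tiling_groupoid_arrowE:
  assumes "g \<in> arrows (tiling_groupoid C)"
  obtains w1 l m w2 where "g = (w1, int_vec l - int_vec m, w2)" "w1 \<in> tilings C" "w2 \<in> tilings C"
    "shift l w1 = shift m w2"
  using assms by (auto simp: tiling_groupoid_sel)

lemma tiling_groupoid_arrowI:
  "w1 \<in> tilings C \<Longrightarrow> w2 \<in> tilings C \<Longrightarrow> shift l w1 = shift m w2 \<Longrightarrow>
    (w1, int_vec l - int_vec m, w2) \<in> arrows (tiling_groupoid C)"
  by (auto simp: tiling_groupoid_sel)

text \<open>A morphism \<open>\<theta>\<close> acts on tilings by replacing an initial segment \<open>r\<close> by \<open>\<theta> r\<close>, and the arrows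
  below are the germs of this action. Comparing initial segments of both tilings, instead of
  prepending to a third one, makes membership easy to push further along the tilings.\<close>

definition germs :: "('a, 'k::finite, 'm) graph_category_scheme \<Rightarrow> ('a \<rightharpoonup> 'a) \<Rightarrow>
    ('a, 'k) tiling_triple set" where
  "germs C \<theta> = {(w1, n, w2). w1 \<in> tilings C \<and> w2 \<in> tilings C \<and>
     (\<exists>l m. n = int_vec l - int_vec m \<and> shift l w1 = shift m w2 \<and> \<theta> (w2 0 m) = Some (w1 0 l))}"

lemma germsE:
  assumes "g \<in> germs C \<theta>"
  obtains w1 l m w2 where "g = (w1, int_vec l - int_vec m, w2)" "w1 \<in> tilings C" "w2 \<in> tilings C"
    "shift l w1 = shift m w2" "\<theta> (w2 0 m) = Some (w1 0 l)"
  using assms by (auto simp: germs_def)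

lemma germsI:
  "w1 \<in> tilings C \<Longrightarrow> w2 \<in> tilings C \<Longrightarrow> shift l w1 = shift m w2 \<Longrightarrow> \<theta> (w2 0 m) = Some (w1 0 l) \<Longrightarrow>
    (w1, int_vec l - int_vec m, w2) \<in> germs C \<theta>"
  by (auto simp: germs_def)

lemma germs_mono: "\<theta> \<subseteq>\<^sub>m \<phi> \<Longrightarrow> germs C \<theta> \<subseteq> germs C \<phi>"
  unfolding germs_def map_le_def by (auto simp: dom_def) metis

lemma germs_empty: "germs C Map.empty = {}"
  by (simp add: germs_def)

lemma germs_subset: "germs C \<theta> \<subseteq> arrows (tiling_groupoid C)"
  by (auto simp: germs_def tiling_groupoid_sel)

context k_graph
begin

lemma germs_raise:
  assumes "fg_morphism C \<theta>" "w1 \<in> tilings C" "w2 \<in> tilings C"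
    and "shift l w1 = shift m w2" "\<theta> (w2 0 m) = Some (w1 0 l)"
  shows "\<theta> (w2 0 (m + p)) = Some (w1 0 (l + p))"
  using fg_morphism_cmp[OF assms(1,5) tiling_split(1)[OF assms(3), of m p]]
    tiling_split(2)[OF assms(3), of m p] tiling_split(2)[OF assms(2), of l p]
    shift_eq_apply0[OF assms(4), of p] by simp

text \<open>Two presentations \<open>(l, m)\<close> and \<open>(l', m')\<close> of one arrow satisfy \<open>l + m' = l' + m\<close>. Hence they
  coincide after the first is pushed along the tilings by \<open>m'\<close> and the second by \<open>m\<close>, and a
  morphism respects such a push.\<close>

lemma germs_iff:
  assumes \<theta>: "fg_morphism C \<theta>" and w: "w1 \<in> tilings C" "w2 \<in> tilings C" "shift l w1 = shift m w2"
  shows "(w1, int_vec l - int_vec m, w2) \<in> germs C \<theta> \<longleftrightarrow> (\<exists>p. \<theta> (w2 0 (m + p)) = Some (w1 0 (l + p)))"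
proof
  assume "(w1, int_vec l - int_vec m, w2) \<in> germs C \<theta>"
  then obtain l' m' where *: "int_vec l - int_vec m = int_vec l' - int_vec m'"
    "shift l' w1 = shift m' w2" "\<theta> (w2 0 m') = Some (w1 0 l')"
    by (auto simp: germs_def)
  then have "l' + m = l + m'"
    by (simp add: int_vec_diff_eq_iff)
  then have "\<theta> (w2 0 (m + m')) = Some (w1 0 (l + m'))"
    using germs_raise[OF \<theta> w(1,2) *(2,3), of m] by (simp add: add.commute)
  then show "\<exists>p. \<theta> (w2 0 (m + p)) = Some (w1 0 (l + p))"
    by blast
next
  assume "\<exists>p. \<theta> (w2 0 (m + p)) = Some (w1 0 (l + p))"
  then obtain p where p: "\<theta> (w2 0 (m + p)) = Some (w1 0 (l + p))" by blast
  have "int_vec (l + p) - int_vec (m + p) = int_vec l - int_vec m"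
    by (simp add: int_vec_add)
  then show "(w1, int_vec l - int_vec m, w2) \<in> germs C \<theta>"
    using germsI[of w1 C w2 "l + p" "m + p" \<theta>] w p shift_eq_add[OF w(3)] by simp
qed

lemma germs_over:
  assumes \<theta>: "fg_morphism C \<theta>" and v: "v \<in> tilings C" "\<theta> (v 0 m) = Some x"
  obtains w where "w \<in> tilings C" "w 0 (deg C x) = x" "shift (deg C x) w = shift m v"
    "(w, int_vec (deg C x) - int_vec m, v) \<in> germs C \<theta>"
proof -
  have "shift m v 0 0 = dm C x"
    using fg_morphism_arrows(3)[OF \<theta> v(2)] v(1) by (simp add: shift_apply tiling_dm0)
  then obtain w where w: "w \<in> tilings C" "w 0 (deg C x) = x" "shift (deg C x) w = shift m v"
    using ex_prepend[OF fg_morphism_arrows(2)[OF \<theta> v(2)] shift_tiling[OF v(1)]] by blast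
  then show ?thesis
    using that germsI[of w C v "deg C x" m \<theta>] v by simp
qed

text \<open>If \<open>\<theta>\<close> has a germ on a tiling, some generator of \<open>dom \<theta>\<close> is an initial segment of the
  tiling, and the finitely many generators have bounded degree.\<close>

lemma germs_dom_bound:
  assumes \<theta>: "fg_morphism C \<theta>"
  obtains N where "\<And>w n v k. (w, n, v) \<in> germs C \<theta> \<Longrightarrow> N \<le> k \<Longrightarrow> v 0 k \<in> dom \<theta>"
proof -
  obtain X where X: "finite X" "X \<subseteq> dom \<theta>" "\<And>r. r \<in> dom \<theta> \<Longrightarrow> \<exists>x\<in>X. prefix_of C x r"
    using fg_morphism_generators[OF \<theta>] by blast
  define N where "N = (\<Sum>x\<in>X. deg C x)"
  have N: "deg C x \<le> N" if "x \<in> X" for x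
    using X(1) that
    by (auto simp: N_def less_eq_vec_def intro!: member_le_sum[of x X "\<lambda>x. deg C x $ i" for i])
  have "v 0 k \<in> dom \<theta>" if g: "(w, n, v) \<in> germs C \<theta>" and k: "N \<le> k" for w n v k
  proof -
    obtain m where v: "v \<in> tilings C" "v 0 m \<in> dom \<theta>"
      using g by (auto simp: germs_def)
    obtain x where x: "x \<in> X" "prefix_of C x (v 0 m)"
      using X(3)[OF v(2)] by blast
    then have "x = v 0 (deg C x)"
      using tiling_prefix_eq[OF v(1)] by simp
    then have "prefix_of C x (v 0 k)"
      using tiling_prefix[OF v(1) order_trans[OF N[OF x(1)] k]] by simp
    then show ?thesis
      using fg_morphism_dom_closed[OF \<theta>] x(1) X(2) by blast
  qed
  then show ?thesis
    by (rule that)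
qed

text \<open>If \<open>\<theta>\<close> and \<open>\<phi>\<close> have a common germ on a tiling beginning with \<open>r\<close>, then \<open>\<theta> r \<cdot> c = \<phi> r \<cdot> c\<close>
  for some \<open>c\<close>, and unique factorization cancels \<open>c\<close>.\<close>

lemma germs_agree:
  assumes \<theta>: "fg_morphism C \<theta>" and \<phi>: "fg_morphism C \<phi>"
    and g: "(w, n, v) \<in> germs C \<theta>" "(w, n, v) \<in> germs C \<phi>"
    and k: "\<theta> (v 0 k) = Some x" "\<phi> (v 0 k) = Some y"
  shows "x = y"
proof -
  obtain l m where lm: "n = int_vec l - int_vec m" "w \<in> tilings C" "v \<in> tilings C"
    "shift l w = shift m v" "\<theta> (v 0 m) = Some (w 0 l)"
    using g(1) by (auto simp: germs_def)
  obtain p where p: "\<phi> (v 0 (m + p)) = Some (w 0 (l + p))"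
    using g(2) germs_iff[OF \<phi> lm(2-4)] lm(1) by blast
  have sh: "shift (l + p) w = shift (m + p) v"
    using lm(4) by (rule shift_eq_add)
  let ?c = "v k (k + (m + p))"
  have c: "composable C (v 0 k) ?c" "v 0 (m + p + k) = v 0 k \<cdot> ?c"
    using tiling_split[OF lm(3), of k "m + p"] by (simp_all add: add.commute)
  have "\<theta> (v 0 (m + p + k)) = Some (w 0 (l + p + k))"
    using germs_raise[OF \<theta> lm(2-5), of "p + k"] by (simp add: add.assoc)
  moreover have "\<phi> (v 0 (m + p + k)) = Some (w 0 (l + p + k))"
    using germs_raise[OF \<phi> lm(2,3) sh p] .
  ultimately have eq: "x \<cdot> ?c = y \<cdot> ?c"
    using fg_morphism_cmp[OF \<theta> k(1) c(1)] fg_morphism_cmp[OF \<phi> k(2) c(1)] c(2) by simp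
  have xc: "composable C x ?c" and yc: "composable C y ?c"
    using fg_morphism_composable[OF \<theta> k(1)] fg_morphism_composable[OF \<phi> k(2)] c(1) by auto
  have "deg C x + deg C ?c = deg C y + deg C ?c"
    using deg_cmp[OF xc] deg_cmp[OF yc] eq by simp
  then show ?thesis
    using cancel(1)[OF xc yc eq] by simp
qed

lemma germs_agreeI:
  assumes \<theta>: "fg_morphism C \<theta>" and \<phi>: "fg_morphism C \<phi>"
    and g: "(w, n, v) \<in> germs C \<theta>" and k: "\<theta> (v 0 k) = Some x" "\<phi> (v 0 k) = Some x"
  shows "(w, n, v) \<in> germs C \<phi>"
proof -
  obtain l m where lm: "n = int_vec l - int_vec m" "w \<in> tilings C" "v \<in> tilings C"
    "shift l w = shift m v" "\<theta> (v 0 m) = Some (w 0 l)"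
    using g by (auto simp: germs_def)
  let ?c = "v k (k + m)"
  have c: "composable C (v 0 k) ?c" "v 0 (m + k) = v 0 k \<cdot> ?c"
    using tiling_split[OF lm(3), of k m] by (simp_all add: add.commute)
  have "\<phi> (v 0 (m + k)) = \<theta> (v 0 (m + k))"
    using fg_morphism_cmp[OF \<theta> k(1) c(1)] fg_morphism_cmp[OF \<phi> k(2) c(1)] c(2) by simp
  also have "\<dots> = Some (w 0 (l + k))"
    using germs_raise[OF \<theta> lm(2-5)] .
  finally show ?thesis
    using germs_iff[OF \<phi> lm(2-4)] lm(1) by blast
qed

lemma idents_tiling_groupoid: "idents (tiling_groupoid C) = {(w, 0, w) | w. w \<in> tilings C}"
proof (intro equalityI subsetI)
  fix e assume "e \<in> {(w, 0 :: int ^ 'k, w) | w. w \<in> tilings C}"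
  then obtain w where w: "e = (w, 0, w)" "w \<in> tilings C" by blast
  have "e = dm (tiling_groupoid C) (w, 0, w)" "(w, 0, w) \<in> arrows (tiling_groupoid C)"
    using w tiling_groupoid_arrowI[of w C w 0 0] by (simp_all add: tiling_groupoid_sel(2-))
  then show "e \<in> idents (tiling_groupoid C)"
    unfolding idents_def by blast
qed (auto simp: idents_def tiling_groupoid_sel)

lemma arrow_groupoid_tiling: "arrow_groupoid (tiling_groupoid C)"
proof -
  let ?G = "tiling_groupoid C"
  have id: "(w, 0, w) \<in> arrows ?G" if "w \<in> tilings C" for w
    using that tiling_groupoid_arrowI[of w C w 0 0] by simp
  have comp: "\<exists>w1 n w2 n' w3. a = (w1, n, w2) \<and> b = (w2, n', w3)" if "composable ?G a b" for a b
    using that by (cases a; cases b) (auto simp: composable_def tiling_groupoid_sel)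
  show ?thesis
  proof
    fix a b assume ab: "composable ?G a b"
    then obtain w1 n w2 n' w3 where *: "a = (w1, n, w2)" "b = (w2, n', w3)"
      using comp by blast
    obtain l m where lm: "n = int_vec l - int_vec m" "shift l w1 = shift m w2" "w1 \<in> tilings C"
      using ab * by (auto simp: composable_def tiling_groupoid_sel)
    obtain l' m' where lm': "n' = int_vec l' - int_vec m'" "shift l' w2 = shift m' w3" "w3 \<in> tilings C"
      using ab * by (auto simp: composable_def tiling_groupoid_sel)
    have "shift (l + l') w1 = shift (m' + m) w3"
      using shift_eq_add[OF lm(2), of l'] shift_eq_add[OF lm'(2), of m] by (simp add: add.commute)
    from tiling_groupoid_arrowI[OF lm(3) lm'(3) this]
    show "cmp ?G a b \<in> arrows ?G"
      by (simp add: * tiling_groupoid_sel(2-) lm(1) lm'(1) int_vec_add algebra_simps)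
    show "dm ?G (cmp ?G a b) = dm ?G b" "rg ?G (cmp ?G a b) = rg ?G a"
      by (simp_all add: * tiling_groupoid_sel)
  next
    fix a b c assume "composable ?G a b" "composable ?G b c"
    then show "cmp ?G (cmp ?G a b) c = cmp ?G a (cmp ?G b c)"
      using comp[of a b] comp[of b c] by (auto simp: tiling_groupoid_sel add.assoc)
  next
    fix a assume "a \<in> arrows ?G"
    then obtain w1 l m w2 where a: "a = (w1, int_vec l - int_vec m, w2)" "w1 \<in> tilings C"
      "w2 \<in> tilings C" "shift l w1 = shift m w2"
      by (rule tiling_groupoid_arrowE)
    show "ginv ?G a \<in> arrows ?G"
      using tiling_groupoid_arrowI[of w2 C w1 m l] a by (simp add: tiling_groupoid_sel(2-))
    show "rg ?G a \<in> idents ?G"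
      using a by (simp add: idents_tiling_groupoid tiling_groupoid_sel(2-))
    show "cmp ?G a (dm ?G a) = a" "cmp ?G (rg ?G a) a = a"
      "dm ?G (ginv ?G a) = rg ?G a" "rg ?G (ginv ?G a) = dm ?G a"
      "cmp ?G (ginv ?G a) a = dm ?G a" "cmp ?G a (ginv ?G a) = rg ?G a"
      by (simp_all add: a(1) tiling_groupoid_sel(2-))
  next
    fix e assume "e \<in> idents ?G"
    then show "e \<in> arrows ?G" "dm ?G e = e" "rg ?G e = e"
      using id by (auto simp: idents_tiling_groupoid tiling_groupoid_sel(2-))
  qed
qed


subsection \<open>Cylinders\<close>

lemma tiling_cylinder_eq:
  assumes "x \<in> arrows C" "y \<in> arrows C" "dm C x = dm C y"
  shows "tiling_cylinder C x y = {(v1, int_vec (deg C x) - int_vec (deg C y), v2) | v1 v2.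
    v1 \<in> tilings C \<and> v2 \<in> tilings C \<and> v1 0 (deg C x) = x \<and> v2 0 (deg C y) = y \<and>
    shift (deg C x) v1 = shift (deg C y) v2}" (is "_ = ?R")
proof (intro equalityI subsetI)
  fix g assume "g \<in> tiling_cylinder C x y"
  then obtain w where w: "w \<in> tilings C" "w 0 0 = dm C x"
    "g = (prepend C x w, int_vec (deg C x) - int_vec (deg C y), prepend C y w)"
    by (auto simp: tiling_cylinder_def tiling_range_def)
  then show "g \<in> ?R"
    using prepend[OF assms(1) w(1,2)] prepend[OF assms(2) w(1)] assms(3) by auto
next
  fix g assume "g \<in> ?R"
  then obtain v1 v2 where v: "g = (v1, int_vec (deg C x) - int_vec (deg C y), v2)"
    "v1 \<in> tilings C" "v2 \<in> tilings C" "v1 0 (deg C x) = x" "v2 0 (deg C y) = y"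
    "shift (deg C x) v1 = shift (deg C y) v2"
    by blast
  let ?w = "shift (deg C x) v1"
  have "?w \<in> tilings C" "?w 0 0 = dm C x"
    using v(2,4) shift_tiling tiling_dm0[OF v(2), of "deg C x"] by (simp_all add: shift_apply)
  moreover have "prepend C x ?w = v1" "prepend C y ?w = v2"
    using v prepend_eq[of v1 x] prepend_eq[of v2 y] by auto
  ultimately show "g \<in> tiling_cylinder C x y"
    unfolding tiling_cylinder_def tiling_range_def v(1) by force
qed

lemma germs_translation:
  assumes xy: "x \<in> arrows C" "y \<in> arrows C" "dm C x = dm C y"
  shows "germs C (translation C x y) = tiling_cylinder C x y"
proof (intro equalityI subsetI)
  fix g assume "g \<in> germs C (translation C x y)"
  then obtain w1 l m w2 where g: "g = (w1, int_vec l - int_vec m, w2)" "w1 \<in> tilings C"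
    "w2 \<in> tilings C" "shift l w1 = shift m w2" "translation C x y (w2 0 m) = Some (w1 0 l)"
    by (rule germsE)
  obtain c where c: "composable C y c" "w2 0 m = y \<cdot> c" "w1 0 l = x \<cdot> c"
    using g(5) by (auto simp: translation_Some)
  have xc: "composable C x c"
    using c(1) xy by (simp add: composable_def)
  have m: "m = deg C y + deg C c" and l: "l = deg C x + deg C c"
    using tiling_deg0[OF g(3), of m] tiling_deg0[OF g(2), of l] c xc by (simp_all add: deg_cmp)
  have x: "w1 0 (deg C x) = x"
    using tiling_prefix_eq[OF g(2), of x l] c(3) prefix_ofI[OF xc] by simp
  have y: "w2 0 (deg C y) = y"
    using tiling_prefix_eq[OF g(3), of y m] c(2) prefix_ofI[OF c(1)] by simp
  have "w1 (deg C x) l = c"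
    using cancel(2)[OF tiling_split(1)[OF g(2), of "deg C x" "deg C c"], of x c] xc x c(3)
      tiling_split(2)[OF g(2), of "deg C x" "deg C c"] by (simp add: l)
  moreover have "w2 (deg C y) m = c"
    using cancel(2)[OF tiling_split(1)[OF g(3), of "deg C y" "deg C c"], of y c] c(1) y c(2)
      tiling_split(2)[OF g(3), of "deg C y" "deg C c"] by (simp add: m)
  ultimately have "shift (deg C x) w1 = shift (deg C y) w2"
    using g(4) tiling_eqI_shift[OF shift_tiling[OF g(2)] shift_tiling[OF g(3)],
        of "deg C x" "deg C c" "deg C y"]
    by (simp add: shift_shift shift_apply flip: l m)
  then show "g \<in> tiling_cylinder C x y"
    unfolding tiling_cylinder_eq[OF xy] using g x y by (auto simp: l m int_vec_add)
next
  fix g assume "g \<in> tiling_cylinder C x y"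
  then obtain v1 v2 where v: "g = (v1, int_vec (deg C x) - int_vec (deg C y), v2)"
    "v1 \<in> tilings C" "v2 \<in> tilings C" "v1 0 (deg C x) = x" "v2 0 (deg C y) = y"
    "shift (deg C x) v1 = shift (deg C y) v2"
    unfolding tiling_cylinder_eq[OF xy] by blast
  then show "g \<in> germs C (translation C x y)"
    using germsI[OF v(2,3,6)] translation_self[OF xy] by simp
qed

lemma translation_at:
  assumes "w1 \<in> tilings C" "w2 \<in> tilings C" "shift l w1 = shift m w2"
  shows "w1 0 l \<in> arrows C" "w2 0 m \<in> arrows C" "dm C (w1 0 l) = dm C (w2 0 m)"
    "(w1, int_vec l - int_vec m, w2) \<in> germs C (translation C (w1 0 l) (w2 0 m))"
proof -
  show *: "w1 0 l \<in> arrows C" "w2 0 m \<in> arrows C" "dm C (w1 0 l) = dm C (w2 0 m)"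
    using assms by (simp_all add: tiling_arrows0 tiling_dm0 shift_eq_ends[OF assms(3)])
  show "(w1, int_vec l - int_vec m, w2) \<in> germs C (translation C (w1 0 l) (w2 0 m))"
    using germsI[OF assms] translation_self[OF *] by simp
qed

lemma gtop_tiling_groupoid:
  "gtop (tiling_groupoid C) = topology_generated_by (germs C ` carrier (R_monoid C))"
    (is "_ = ?T")
proof -
  let ?B = "{tiling_cylinder C x y | x y. x \<in> arrows C \<and> y \<in> arrows C \<and> dm C x = dm C y}"
  have sub: "?B \<subseteq> germs C ` carrier (R_monoid C)"
    unfolding R_monoid_carrier using germs_translation fg_morphism_translation by blast
  have base: "openin (topology_generated_by ?B) (germs C \<theta>)" if \<theta>: "fg_morphism C \<theta>" for \<theta>
  proof (subst openin_subopen, intro ballI)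
    fix g assume "g \<in> germs C \<theta>"
    then obtain w1 l m w2 where g: "g = (w1, int_vec l - int_vec m, w2)" "w1 \<in> tilings C"
      "w2 \<in> tilings C" "shift l w1 = shift m w2" "\<theta> (w2 0 m) = Some (w1 0 l)"
      by (rule germsE)
    note tr = translation_at[OF g(2-4)]
    have "tiling_cylinder C (w1 0 l) (w2 0 m) \<subseteq> germs C \<theta>"
      using germs_mono[OF translation_map_le[OF \<theta> g(5)], of C] germs_translation[OF tr(1-3)] by simp
    moreover have "g \<in> tiling_cylinder C (w1 0 l) (w2 0 m)"
      using tr(4) germs_translation[OF tr(1-3)] g(1) by simp
    moreover have "openin (topology_generated_by ?B) (tiling_cylinder C (w1 0 l) (w2 0 m))"
      using tr(1-3) by (intro topology_generated_by_Basis) blast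
    ultimately show "\<exists>T. openin (topology_generated_by ?B) T \<and> g \<in> T \<and> T \<subseteq> germs C \<theta>"
      by blast
  qed
  have *: "openin (topology_generated_by ?B) V"
    if "generate_topology_on (germs C ` carrier (R_monoid C)) V" for V
    using that
    by (induction rule: generate_topology_on.induct) (auto simp: R_monoid_carrier intro: base)
  have **: "openin ?T V" if "generate_topology_on ?B V" for V
    using that
  proof (induction rule: generate_topology_on.induct)
    case (Basis V)
    then show ?case
      using sub by (intro topology_generated_by_Basis) blast
  qed auto
  have "openin (topology_generated_by ?B) V \<longleftrightarrow> openin ?T V" for V
    using *[of V] **[of V] by (auto simp: openin_topology_generated_by_iff)
  then show ?thesis
    by (simp add: tiling_groupoid_def topology_eq)
qed


subsection \<open>Compatibility with the operations\<close>

lemma germs_minv: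
  assumes "fg_morphism C \<theta>"
  shows "germs C (minv (R_monoid C) \<theta>) = ginv (tiling_groupoid C) ` germs C \<theta>"
proof (intro equalityI subsetI)
  fix g assume "g \<in> germs C (minv (R_monoid C) \<theta>)"
  then obtain w1 l m w2 where g: "g = (w1, int_vec l - int_vec m, w2)" "w1 \<in> tilings C"
    "w2 \<in> tilings C" "shift l w1 = shift m w2" "minv (R_monoid C) \<theta> (w2 0 m) = Some (w1 0 l)"
    by (rule germsE)
  then have "(w2, int_vec m - int_vec l, w1) \<in> germs C \<theta>"
    using minv_R_monoid[OF assms] by (intro germsI) auto
  moreover have "g = ginv (tiling_groupoid C) (w2, int_vec m - int_vec l, w1)"
    by (simp add: g(1) tiling_groupoid_sel(2-))
  ultimately show "g \<in> ginv (tiling_groupoid C) ` germs C \<theta>"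
    by blast
next
  fix g assume "g \<in> ginv (tiling_groupoid C) ` germs C \<theta>"
  then obtain h where h: "h \<in> germs C \<theta>" "g = ginv (tiling_groupoid C) h"
    by blast
  obtain w1 l m w2 where *: "h = (w1, int_vec l - int_vec m, w2)" "w1 \<in> tilings C"
    "w2 \<in> tilings C" "shift l w1 = shift m w2" "\<theta> (w2 0 m) = Some (w1 0 l)"
    using h(1) by (rule germsE)
  then have "(w2, int_vec m - int_vec l, w1) \<in> germs C (minv (R_monoid C) \<theta>)"
    using minv_R_monoid[OF assms] by (intro germsI) auto
  then show "g \<in> germs C (minv (R_monoid C) \<theta>)"
    by (simp add: h(2) *(1) tiling_groupoid_sel(2-))
qed

lemma germs_mult:
  assumes \<theta>: "fg_morphism C \<theta>" and \<phi>: "fg_morphism C \<phi>"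
  shows "germs C (\<theta> \<circ>\<^sub>m \<phi>) = set_cmp (tiling_groupoid C) (germs C \<theta>) (germs C \<phi>)"
proof (intro equalityI subsetI)
  fix k assume "k \<in> germs C (\<theta> \<circ>\<^sub>m \<phi>)"
  then obtain w1 l m w3 where k: "k = (w1, int_vec l - int_vec m, w3)" "w1 \<in> tilings C"
    "w3 \<in> tilings C" "shift l w1 = shift m w3" "(\<theta> \<circ>\<^sub>m \<phi>) (w3 0 m) = Some (w1 0 l)"
    by (rule germsE)
  obtain y where y: "\<phi> (w3 0 m) = Some y" "\<theta> y = Some (w1 0 l)"
    using k(5) by (auto simp: map_comp_Some_iff)
  obtain w2 where w2: "w2 \<in> tilings C" "w2 0 (deg C y) = y" "shift (deg C y) w2 = shift m w3"
    "(w2, int_vec (deg C y) - int_vec m, w3) \<in> germs C \<phi>"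
    using germs_over[OF \<phi> k(3) y(1)] .
  have g: "(w1, int_vec l - int_vec (deg C y), w2) \<in> germs C \<theta>"
    using k y w2 by (intro germsI) auto
  have "k = cmp (tiling_groupoid C) (w1, int_vec l - int_vec (deg C y), w2)
      (w2, int_vec (deg C y) - int_vec m, w3)"
    by (simp add: k(1) tiling_groupoid_sel(2-))
  moreover have "composable (tiling_groupoid C) (w1, int_vec l - int_vec (deg C y), w2)
      (w2, int_vec (deg C y) - int_vec m, w3)"
    using g w2(4) germs_subset unfolding composable_def tiling_groupoid_sel(2-) by blast
  ultimately show "k \<in> set_cmp (tiling_groupoid C) (germs C \<theta>) (germs C \<phi>)"
    using g w2(4) unfolding set_cmp_def by blast
next
  fix k assume "k \<in> set_cmp (tiling_groupoid C) (germs C \<theta>) (germs C \<phi>)"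
  then obtain g h where gh: "g \<in> germs C \<theta>" "h \<in> germs C \<phi>" "composable (tiling_groupoid C) g h"
    "k = cmp (tiling_groupoid C) g h"
    unfolding set_cmp_def by blast
  obtain w1 l m w2 where g: "g = (w1, int_vec l - int_vec m, w2)" "w1 \<in> tilings C"
    "w2 \<in> tilings C" "shift l w1 = shift m w2" "\<theta> (w2 0 m) = Some (w1 0 l)"
    using gh(1) by (rule germsE)
  obtain w2' l' m' w3 where h: "h = (w2', int_vec l' - int_vec m', w3)" "w2' \<in> tilings C"
    "w3 \<in> tilings C" "shift l' w2' = shift m' w3" "\<phi> (w3 0 m') = Some (w2' 0 l')"
    using gh(2) by (rule germsE)
  have w2': "w2' = w2"
    using gh(3) g(1) h(1) by (simp add: composable_def tiling_groupoid_sel(2-))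
  have "\<phi> (w3 0 (m' + m)) = Some (w2 0 (m + l'))"
    using germs_raise[OF \<phi> h(2-5), of m] by (simp add: w2' add.commute)
  moreover have "\<theta> (w2 0 (m + l')) = Some (w1 0 (l + l'))"
    using germs_raise[OF \<theta> g(2-5)] .
  moreover have "shift (l + l') w1 = shift (m' + m) w3"
    using shift_eq_add[OF g(4), of l'] shift_eq_add[OF h(4), of m] by (simp add: w2' add.commute)
  ultimately have "(w1, int_vec (l + l') - int_vec (m' + m), w3) \<in> germs C (\<theta> \<circ>\<^sub>m \<phi>)"
    using g(2) h(3) by (intro germsI) auto
  then show "k \<in> germs C (\<theta> \<circ>\<^sub>m \<phi>)"
    by (simp add: gh(4) g(1) h(1) tiling_groupoid_sel(2-) int_vec_add algebra_simps)
qed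

lemma germs_bisection:
  assumes \<theta>: "fg_morphism C \<theta>"
  shows "inj_on (dm (tiling_groupoid C)) (germs C \<theta>)"
proof (rule inj_onI)
  fix g h assume gh: "g \<in> germs C \<theta>" "h \<in> germs C \<theta>"
    "dm (tiling_groupoid C) g = dm (tiling_groupoid C) h"
  obtain w1 l m w2 where g: "g = (w1, int_vec l - int_vec m, w2)" "w1 \<in> tilings C"
    "w2 \<in> tilings C" "shift l w1 = shift m w2" "\<theta> (w2 0 m) = Some (w1 0 l)"
    using gh(1) by (rule germsE)
  obtain v1 l' m' v2 where h: "h = (v1, int_vec l' - int_vec m', v2)" "v1 \<in> tilings C"
    "v2 \<in> tilings C" "shift l' v1 = shift m' v2" "\<theta> (v2 0 m') = Some (v1 0 l')"
    using gh(2) by (rule germsE)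
  have v2: "v2 = w2"
    using gh(3) g(1) h(1) by (simp add: tiling_groupoid_sel(2-))
  have "Some (w1 0 (l + m')) = Some (v1 0 (l' + m))"
    using germs_raise[OF \<theta> g(2-5), of m'] germs_raise[OF \<theta> h(2-5), of m]
    by (simp add: v2 add.commute)
  then have eq: "w1 0 (l + m') = v1 0 (l' + m)"
    by simp
  then have deg: "l + m' = l' + m"
    using tiling_deg0[OF g(2), of "l + m'"] tiling_deg0[OF h(2), of "l' + m"] by simp
  have "shift (l + m') w1 = shift (l' + m) v1"
    using shift_eq_add[OF g(4), of m'] shift_eq_add[OF h(4), of m] by (simp add: v2 add.commute)
  then have "w1 = v1"
    using tiling_eqI_shift[OF g(2) h(2), of "l + m'"] eq deg by simp
  moreover have "int_vec l - int_vec m = int_vec l' - int_vec m'"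
    using deg by (simp add: int_vec_diff_eq_iff)
  ultimately show "g = h"
    by (simp add: g(1) h(1) v2)
qed

end


section \<open>Row-finite graphs without sources\<close>

text \<open>A finitary form of compactness: if no \<open>k \<in> K\<close> worked for all of the directed set \<open>D\<close>, finitely
  many counterexamples would have a common lower bound, for which no \<open>k\<close> works at all.\<close>

lemma directed_pigeonhole:
  assumes "finite K" "D \<noteq> {}"
    and dir: "\<And>s t. s \<in> D \<Longrightarrow> t \<in> D \<Longrightarrow> \<exists>r\<in>D. \<forall>k\<in>K. Q r k \<longrightarrow> Q s k \<and> Q t k"
    and ex: "\<And>s. s \<in> D \<Longrightarrow> \<exists>k\<in>K. Q s k"
  shows "\<exists>k\<in>K. \<forall>s\<in>D. Q s k"
proof (rule ccontr)
  assume none: "\<not> ?thesis"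
  have "finite L \<Longrightarrow> L \<subseteq> K \<Longrightarrow> \<exists>r\<in>D. \<forall>k\<in>L. \<not> Q r k" for L
  proof (induction rule: finite_induct)
    case empty
    then show ?case
      using assms(2) by auto
  next
    case (insert l L)
    then obtain r where r: "r \<in> D" "\<forall>k\<in>L. \<not> Q r k"
      by auto
    obtain s where s: "s \<in> D" "\<not> Q s l"
      using none insert.prems by auto
    obtain t where "t \<in> D" "\<forall>k\<in>K. Q t k \<longrightarrow> Q r k \<and> Q s k"
      using dir[OF r(1) s(1)] by blast
    then show ?case
      using r s insert.prems by blast
  qed
  from this[OF assms(1)] show False
    using ex by blast
qed

locale row_finite_k_graph = k_graph C
  for C :: "('a, 'k::finite, 'm) graph_category_scheme" (structure) +
  assumes finite_idents: "finite (idents C)"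
    and row_finite: "row_finite C"
    and no_sources: "no_sources C"
begin

lemma ex_tiling:
  assumes "e \<in> idents C"
  shows "\<exists>w\<in>tilings C. w 0 0 = e"
proof -
  have "\<exists>c. composable C z c \<and> deg C c = 1 \<and> True" if "z \<in> arrows C" for z
    using no_sources dm_idents[OF that] that unfolding no_sources_def composable_def by metis
  from tiling_growth[OF assms TrueI this] show ?thesis
    by auto
qed

lemma germs_nonempty:
  assumes \<theta>: "fg_morphism C \<theta>" and "\<theta> \<noteq> Map.empty"
  shows "germs C \<theta> \<noteq> {}"
proof -
  obtain y x where yx: "\<theta> y = Some x"
    using assms(2) by fastforce
  have y: "y \<in> arrows C"
    using fg_morphism_arrows(1)[OF \<theta> yx] .
  obtain u where "u \<in> tilings C" "u 0 0 = dm C y"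
    using ex_tiling[OF dm_idents[OF y]] by blast
  then obtain v where v: "v \<in> tilings C" "v 0 (deg C y) = y"
    using ex_prepend[OF y] by blast
  then show ?thesis
    using germs_over[OF \<theta> v(1), of "deg C y" x] yx by auto
qed

lemma germs_meet:
  assumes \<theta>: "fg_morphism C \<theta>" and \<phi>: "fg_morphism C \<phi>" and g: "g \<in> germs C \<theta>" "g \<in> germs C \<phi>"
  obtains x y where "fg_morphism C (translation C x y)" "g \<in> germs C (translation C x y)"
    "translation C x y \<subseteq>\<^sub>m \<theta>" "translation C x y \<subseteq>\<^sub>m \<phi>"
proof -
  obtain w1 l m w2 where w: "g = (w1, int_vec l - int_vec m, w2)" "w1 \<in> tilings C"
    "w2 \<in> tilings C" "shift l w1 = shift m w2" "\<theta> (w2 0 m) = Some (w1 0 l)"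
    using g(1) by (rule germsE)
  obtain p where p: "\<phi> (w2 0 (m + p)) = Some (w1 0 (l + p))"
    using g(2) germs_iff[OF \<phi> w(2-4)] w(1) by blast
  have \<theta>p: "\<theta> (w2 0 (m + p)) = Some (w1 0 (l + p))"
    using germs_raise[OF \<theta> w(2-5)] .
  note tr = translation_at[OF w(2,3) shift_eq_add[OF w(4), of p]]
  show ?thesis
    by (rule that[OF fg_morphism_translation[OF tr(1-3)] _
        translation_map_le[OF \<theta> \<theta>p] translation_map_le[OF \<phi> p]])
      (use tr(4) in \<open>simp add: w(1) int_vec_add\<close>)
qed

text \<open>Far enough along the domain of \<open>g\<close>, an initial segment decides whether \<open>\<theta>\<close> is defined and
  what its germ is. If a cylinder of \<open>g\<close> that long met the germs of \<open>\<theta>\<close>, then \<open>\<theta>\<close> would have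
  there the same germ as the translation that defines the cylinder, namely \<open>g\<close>.\<close>

lemma germs_clopen:
  assumes \<theta>: "fg_morphism C \<theta>" and g: "g \<in> arrows (tiling_groupoid C)" "g \<notin> germs C \<theta>"
  obtains x y where "fg_morphism C (translation C x y)" "g \<in> germs C (translation C x y)"
    "germs C (translation C x y) \<inter> germs C \<theta> = {}"
proof -
  obtain w1 l m w2 where w: "g = (w1, int_vec l - int_vec m, w2)" "w1 \<in> tilings C"
    "w2 \<in> tilings C" "shift l w1 = shift m w2"
    using g(1) by (rule tiling_groupoid_arrowE)
  obtain N where N: "\<And>w n v k. (w, n, v) \<in> germs C \<theta> \<Longrightarrow> N \<le> k \<Longrightarrow> v 0 k \<in> dom \<theta>"
    using germs_dom_bound[OF \<theta>] by blast
  let ?x = "w1 0 (l + N)" and ?y = "w2 0 (m + N)"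
  note tr = translation_at[OF w(2,3) shift_eq_add[OF w(4), of N]]
  have tau: "fg_morphism C (translation C ?x ?y)"
    using fg_morphism_translation[OF tr(1-3)] .
  have False if h: "h \<in> germs C (translation C ?x ?y)" "h \<in> germs C \<theta>" for h
  proof -
    obtain v1 n v2 where v: "h = (v1, n, v2)"
      by (cases h)
    have "v2 0 (m + N) = ?y"
      using h(1) tiling_deg0[OF w(3), of "m + N"]
      unfolding v germs_translation[OF tr(1-3)] tiling_cylinder_eq[OF tr(1-3)] by auto
    moreover have "N \<le> m + N"
      by (simp add: less_eq_vec_def)
    ultimately obtain x where x: "\<theta> ?y = Some x"
      using N[of v1 n v2 "m + N"] h(2) v by auto
    have "x = ?x"
      using germs_agree[OF \<theta> tau, of v1 n v2 "m + N" x ?x] h v x translation_self[OF tr(1-3)]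
        \<open>v2 0 (m + N) = ?y\<close> by simp
    then have "g \<in> germs C \<theta>"
      using germs_iff[OF \<theta> w(2-4)] x w(1) by blast
    with g(2) show False ..
  qed
  then have "germs C (translation C ?x ?y) \<inter> germs C \<theta> = {}"
    by blast
  from that[OF tau _ this] show ?thesis
    using tr(4) by (simp add: w(1) int_vec_add)
qed

lemma germs_separated:
  assumes g: "g \<in> arrows (tiling_groupoid C)"
    and le: "\<And>\<theta>. fg_morphism C \<theta> \<Longrightarrow> g \<in> germs C \<theta> \<Longrightarrow> h \<in> germs C \<theta>"
  shows "g = h"
proof -
  obtain w1 l m w2 where w: "g = (w1, int_vec l - int_vec m, w2)" "w1 \<in> tilings C"
    "w2 \<in> tilings C" "shift l w1 = shift m w2"
    using g by (rule tiling_groupoid_arrowE)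
  obtain v1 n v2 where v: "h = (v1, n, v2)"
    by (cases h)
  have *: "v1 \<in> tilings C \<and> v2 \<in> tilings C \<and> n = int_vec l - int_vec m \<and>
      v1 0 (l + p) = w1 0 (l + p) \<and> v2 0 (m + p) = w2 0 (m + p)" for p
  proof -
    note tr = translation_at[OF w(2,3) shift_eq_add[OF w(4), of p]]
    have "h \<in> germs C (translation C (w1 0 (l + p)) (w2 0 (m + p)))"
      using le[OF fg_morphism_translation[OF tr(1-3)]] tr(4) by (simp add: w(1) int_vec_add)
    then show ?thesis
      unfolding v germs_translation[OF tr(1-3)] tiling_cylinder_eq[OF tr(1-3)]
      using w(2,3) by (auto simp: tiling_deg0 int_vec_add)
  qed
  have "v1 = w1" "v2 = w2"
    using * w(2,3) tiling_eqI by metis+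
  with * show ?thesis
    by (simp add: w(1) v)
qed

text \<open>Compactness. Fix \<open>\<theta>\<^sub>0 \<in> D\<close> and call an arrow \<open>z\<close> large if every bisection of the family
  meets that of \<open>\<theta>\<^sub>0\<close> in an arrow whose domain begins with \<open>z\<close>. Since there are finitely many
  identities and finitely many arrows of degree \<open>(1, \<dots>, 1)\<close> to continue with, some identity is
  large and every large arrow has a large continuation. The tiling obtained in the limit is the
  domain of an arrow of the bisection of \<open>\<theta>\<^sub>0\<close>, which lies in all the others.\<close>

lemma germs_compact:
  assumes D: "\<And>\<theta>. \<theta> \<in> D \<Longrightarrow> fg_morphism C \<theta>" "D \<noteq> {}"
    and ne: "\<And>\<theta>. \<theta> \<in> D \<Longrightarrow> germs C \<theta> \<noteq> {}"
    and dir: "\<And>\<theta> \<phi>. \<theta> \<in> D \<Longrightarrow> \<phi> \<in> D \<Longrightarrow> \<exists>\<psi>\<in>D. germs C \<psi> \<subseteq> germs C \<theta> \<inter> germs C \<phi>"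
  shows "\<exists>g. \<forall>\<theta>\<in>D. g \<in> germs C \<theta>"
proof -
  obtain \<theta>0 where \<theta>0: "\<theta>0 \<in> D"
    using D(2) by blast
  define Q where "Q \<theta> z \<longleftrightarrow> (\<exists>w n v. (w, n, v) \<in> germs C \<theta> \<inter> germs C \<theta>0 \<and> v 0 (deg C z) = z)" for \<theta> z
  have Q_mono: "Q \<phi> z" if "Q \<theta> z" "germs C \<theta> \<subseteq> germs C \<phi>" for \<theta> \<phi> z
    using that unfolding Q_def by blast
  have dirQ: "\<exists>\<psi>\<in>D. \<forall>k\<in>K. Q \<psi> (f k) \<longrightarrow> Q \<theta> (f k) \<and> Q \<phi> (f k)" if "\<theta> \<in> D" "\<phi> \<in> D" for \<theta> \<phi> K and f :: "'a \<Rightarrow> 'a"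
    using dir[OF that] Q_mono by (meson le_inf_iff)
  have "\<exists>e\<in>idents C. \<forall>\<theta>\<in>D. Q \<theta> e"
  proof (rule directed_pigeonhole[OF finite_idents D(2)])
    show "\<exists>\<psi>\<in>D. \<forall>k\<in>idents C. Q \<psi> k \<longrightarrow> Q \<theta> k \<and> Q \<phi> k" if "\<theta> \<in> D" "\<phi> \<in> D" for \<theta> \<phi>
      using dirQ[OF that, of _ "\<lambda>k. k"] .
    fix \<theta> assume "\<theta> \<in> D"
    then obtain \<psi> where "\<psi> \<in> D" "germs C \<psi> \<subseteq> germs C \<theta> \<inter> germs C \<theta>0"
      using dir \<theta>0 by blast
    then obtain w n v where g: "(w, n, v) \<in> germs C \<theta> \<inter> germs C \<theta>0"
      using ne[of \<psi>] by fastforce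
    then have "v 0 0 \<in> idents C"
      by (auto simp: germs_def tiling_ident)
    then show "\<exists>e\<in>idents C. Q \<theta> e"
      using g deg_ident unfolding Q_def by (intro bexI[of _ "v 0 0"]) auto
  qed
  then obtain e where e: "e \<in> idents C" "\<forall>\<theta>\<in>D. Q \<theta> e" by blast
  have "\<exists>c. composable C z c \<and> deg C c = 1 \<and> (\<forall>\<theta>\<in>D. Q \<theta> (z \<cdot> c))"
    if z: "z \<in> arrows C" "\<forall>\<theta>\<in>D. Q \<theta> z" for z
  proof -
    let ?K = "{c \<in> arrows C. rg C c = dm C z \<and> deg C c = 1}"
    have "\<exists>c\<in>?K. \<forall>\<theta>\<in>D. Q \<theta> (z \<cdot> c)"
    proof (rule directed_pigeonhole[OF _ D(2)])
      show "finite ?K"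
        using row_finite dm_idents[OF z(1)] unfolding row_finite_def by blast
      show "\<exists>\<psi>\<in>D. \<forall>k\<in>?K. Q \<psi> (z \<cdot> k) \<longrightarrow> Q \<theta> (z \<cdot> k) \<and> Q \<phi> (z \<cdot> k)" if "\<theta> \<in> D" "\<phi> \<in> D" for \<theta> \<phi>
        using dirQ[OF that, of _ "\<lambda>k. z \<cdot> k"] .
      fix \<theta> assume "\<theta> \<in> D"
      then obtain w n v where g: "(w, n, v) \<in> germs C \<theta> \<inter> germs C \<theta>0" "v 0 (deg C z) = z"
        using z(2) unfolding Q_def by blast
      then have v: "v \<in> tilings C"
        by (auto simp: germs_def)
      let ?c = "v (deg C z) (deg C z + 1)"
      have c: "composable C z ?c" "v 0 (deg C z + 1) = z \<cdot> ?c"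
        using tiling_split[OF v, of "deg C z" 1] g(2) by simp_all
      moreover have "deg C ?c = 1"
        using tiling_deg[OF v le_add_vec] by (simp add: diff_add_vec)
      moreover have "deg C (z \<cdot> ?c) = deg C z + 1"
        using tiling_deg0[OF v, of "deg C z + 1"] c(2) by simp
      ultimately have "?c \<in> ?K" "Q \<theta> (z \<cdot> ?c)"
        using g(1) unfolding Q_def composable_def by auto
      then show "\<exists>c\<in>?K. Q \<theta> (z \<cdot> c)"
        by blast
    qed
    then show ?thesis
      using z(1) by (auto simp: composable_def)
  qed
  from tiling_growth[OF e this]
  obtain u where u: "u \<in> tilings C" "\<And>j \<theta>. \<theta> \<in> D \<Longrightarrow> Q \<theta> (u 0 (\<chi> i. j))"
    by blast
  have meet: "\<exists>w n v. (w, n, v) \<in> germs C \<theta> \<inter> germs C \<theta>0 \<and> v 0 (\<chi> i. j) = u 0 (\<chi> i. j)"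
    if "\<theta> \<in> D" for \<theta> j
    using u(2)[OF that, of j] tiling_deg0[OF u(1)] unfolding Q_def by simp
  have cofinal: "\<exists>j :: nat. N \<le> (\<chi> i. j) \<and> N' \<le> (\<chi> i. j)" for N N' :: "nat ^ 'k"
  proof (intro exI conjI)
    let ?j = "\<Sum>i\<in>UNIV. N $ i + N' $ i"
    have le: "N $ i + N' $ i \<le> ?j" for i
      by (rule member_le_sum) auto
    show "N \<le> (\<chi> i. ?j)" "N' \<le> (\<chi> i. ?j)"
      unfolding less_eq_vec_def vec_lambda_beta
      by (intro allI add_leD1[OF le] add_leD2[OF le])+
  qed
  have agree: "\<exists>k x. \<theta> (u 0 k) = Some x \<and> \<theta>0 (u 0 k) = Some x" if \<theta>: "\<theta> \<in> D" for \<theta>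
  proof -
    obtain N where N: "\<And>w n v k. (w, n, v) \<in> germs C \<theta> \<Longrightarrow> N \<le> k \<Longrightarrow> v 0 k \<in> dom \<theta>"
      using germs_dom_bound[OF D(1)[OF \<theta>]] by blast
    obtain N0 where N0: "\<And>w n v k. (w, n, v) \<in> germs C \<theta>0 \<Longrightarrow> N0 \<le> k \<Longrightarrow> v 0 k \<in> dom \<theta>0"
      using germs_dom_bound[OF D(1)[OF \<theta>0]] by blast
    obtain j :: nat where j: "N \<le> (\<chi> i. j)" "N0 \<le> (\<chi> i. j)"
      using cofinal by blast
    obtain w n v where g: "(w, n, v) \<in> germs C \<theta>" "(w, n, v) \<in> germs C \<theta>0"
      "v 0 (\<chi> i. j) = u 0 (\<chi> i. j)"
      using meet[OF \<theta>, of j] by blast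
    obtain x y where xy: "\<theta> (v 0 (\<chi> i. j)) = Some x" "\<theta>0 (v 0 (\<chi> i. j)) = Some y"
      using N[OF g(1) j(1)] N0[OF g(2) j(2)] by blast
    then have "x = y"
      using germs_agree[OF D(1)[OF \<theta>] D(1)[OF \<theta>0] g(1,2)] by blast
    with xy g(3) show ?thesis
      by auto
  qed
  obtain k0 x0 where k0: "\<theta>0 (u 0 k0) = Some x0"
    using agree[OF \<theta>0] by blast
  obtain w n where g: "(w, n, u) \<in> germs C \<theta>0"
    using germs_over[OF D(1)[OF \<theta>0] u(1) k0] by blast
  have "(w, n, u) \<in> germs C \<theta>" if \<theta>: "\<theta> \<in> D" for \<theta>
    using agree[OF \<theta>] germs_agreeI[OF D(1)[OF \<theta>0] D(1)[OF \<theta>] g] by blast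
  then show ?thesis
    by blast
qed

lemma germs_representation:
  "bisection_representation (tiling_groupoid C) (R_monoid C) (germs C)"
proof -
  interpret T: arrow_groupoid "tiling_groupoid C"
    by (rule arrow_groupoid_tiling)
  have mult: "\<theta> \<otimes>\<^bsub>R_monoid C\<^esub> \<phi> = \<theta> \<circ>\<^sub>m \<phi>" for \<theta> \<phi>
    by (simp add: R_monoid_def)
  have zero: "mzero (R_monoid C) = Map.empty"
    by (simp add: R_monoid_def)
  show ?thesis
  proof (unfold_locales, unfold R_monoid_carrier mem_Collect_eq mult)
    show "fg_morphism C (\<theta> \<circ>\<^sub>m \<phi>)" if "fg_morphism C \<theta>" "fg_morphism C \<phi>" for \<theta> \<phi>
      using that row_finite by (rule fg_morphism_comp)
    show "germs C \<theta> \<noteq> {}" if "fg_morphism C \<theta>" "\<theta> \<noteq> mzero (R_monoid C)" for \<theta>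
      using that germs_nonempty by (simp add: zero)
    show "\<exists>\<psi>\<in>{\<theta>. fg_morphism C \<theta>}. g \<in> germs C \<psi> \<and> nat_le (R_monoid C) \<psi> \<theta> \<and> nat_le (R_monoid C) \<psi> \<phi>"
      if "fg_morphism C \<theta>" "fg_morphism C \<phi>" "g \<in> germs C \<theta>" "g \<in> germs C \<phi>" for \<theta> \<phi> g
      using germs_meet[OF that] nat_le_R_monoidI by (metis mem_Collect_eq)
    show "\<exists>\<theta>\<in>{\<theta>. fg_morphism C \<theta>}. g \<in> germs C \<theta>" if "g \<in> arrows (tiling_groupoid C)" for g
      using that translation_at fg_morphism_translation
      by (elim tiling_groupoid_arrowE) (metis mem_Collect_eq)
    show "\<exists>\<phi>\<in>{\<theta>. fg_morphism C \<theta>}. g \<in> germs C \<phi> \<and> germs C \<phi> \<inter> germs C \<theta> = {}"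
      if "fg_morphism C \<theta>" "g \<in> arrows (tiling_groupoid C)" "g \<notin> germs C \<theta>" for \<theta> g
      using germs_clopen[OF that] by (metis mem_Collect_eq)
    show "\<exists>g. \<forall>\<theta>\<in>D. g \<in> germs C \<theta>"
      if "D \<subseteq> {\<theta>. fg_morphism C \<theta>}" "D \<noteq> {}" "\<And>\<theta>. \<theta> \<in> D \<Longrightarrow> germs C \<theta> \<noteq> {}"
        "\<And>\<theta> \<phi>. \<theta> \<in> D \<Longrightarrow> \<phi> \<in> D \<Longrightarrow> \<exists>\<psi>\<in>D. germs C \<psi> \<subseteq> germs C \<theta> \<inter> germs C \<phi>" for D
      using that by (intro germs_compact) auto
    show "g = h" if "g \<in> arrows (tiling_groupoid C)"
      "\<And>\<theta>. fg_morphism C \<theta> \<Longrightarrow> g \<in> germs C \<theta> \<Longrightarrow> h \<in> germs C \<theta>" for g h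
      using that by (rule germs_separated)
    show "gtop (tiling_groupoid C) = topology_generated_by (germs C ` {\<theta>. fg_morphism C \<theta>})"
      using gtop_tiling_groupoid by (simp add: R_monoid_carrier)
  qed (auto simp: zero fg_morphism_minv fg_morphism_empty germs_mult germs_minv germs_empty
      germs_bisection subsetD[OF germs_subset])
qed

end

theorem mainTheorem6:
  fixes C :: "('a, 'k::finite) graph_category"
  assumes "k_graph C" and "finite (idents C)" and "row_finite C" and "no_sources C"
  shows "topological_groupoid (tiling_groupoid C) \<and>
    etale_groupoid (ultrafilter_groupoid (B_monoid C)) \<and>
    isomorphic_topological_groupoids (tiling_groupoid C) (ultrafilter_groupoid (B_monoid C))"
proof -
  interpret row_finite_k_graph C
    using assms by (simp add: row_finite_k_graph_def row_finite_k_graph_axioms_def)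
  interpret bisection_representation "tiling_groupoid C" "R_monoid C" "germs C"
    by (rule germs_representation)
  show ?thesis
    using topological etale_isomorphic_ultrafilter_groupoid by (simp add: B_monoid_def)
qed

end
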